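(* Let $(\mathbb{N}_0,b,m)$ be a birth-death chain and let $W:\mathbb{N}_0\to\mathbb{R}$ be a potential such that the Schr\"odinger operator $L_c+W$ on $\ell^2(\mathbb{N}_0,m)$ is semi-bounded with lower bound $K\in\mathbb{R}$. For $\lambda\in\mathbb{R}$ put $$\Theta=\Theta(\lambda)=1+\frac{(W(0)-\lambda)\,m(0)}{b(0,1)},$$ and for an integer $k$ and a tuple $(\ell_1,\dots,\ell_r)$ of integers put $c_{k,i}=c_{k,i}((\ell_n))=k-\sum_{n=1}^{i}\ell_n$. Define $\alpha_0=\Theta$, $\beta_0=0$, and for $k\ge 1$ $$\alpha_k=\Theta\sum_{r=1}^{k}\ \sum_{\substack{(\ell_1,\dots,\ell_r)\\ \ell_j\in\{1,2\}\\ \ell_1+\dots+\ell_r=k}}\left(\ \prod_{\substack{1\le i\le r\\ \ell_i=1}}\left(1+\frac{b(c_{k,i},c_{k,i}+1)+(W(c_{k,i}+1)-\lambda)\,m(c_{k,i}+1)}{b(c_{k,i}+1,c_{k,i}+2)}\right)\prod_{\substack{1\le i\le r\\ \ell_i=2}}\left(\frac{-b(c_{k,i}+1,c_{k,i}+2)}{b(c_{k,i}+2,c_{k,i}+3)}\right)\right),$$ $$\beta_k=\sum_{r=1}^{k+1}\ \sum_{\substack{(\ell_1,\dots,\ell_r)\\ \ell_j\in\{1,2\}\\ \ell_1+\dots+\ell_r=k+1\\ \ell_r=2}}\left(\ \prod_{\substack{1\le i\le r\\ \ell_i=1}}\left(1+\frac{b(c_{k,i},c_{k,i}+1)+(W(c_{k,i}+1)-\lambda)\,m(c_{k,i}+1)}{b(c_{k,i}+1,c_{k,i}+2)}\right)\prod_{\substack{1\le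 i\le r\\ \ell_i=2}}\left(\frac{-b(c_{k,i}+1,c_{k,i}+2)}{b(c_{k,i}+2,c_{k,i}+3)}\right)\right).$$ Then the following statements are equivalent: (1) $\displaystyle\sum_{k=0}^{\infty}(\alpha_k+\beta_k)^2\,m(k+1)=\infty$ for some $\lambda<K$; (2) $L_c+W$ is essentially self-adjoint.
   Context: $\mathbb{N}_0=\{0,1,2,\dots\}$. A birth-death chain $(\mathbb{N}_0,b,m)$ consists of a symmetric edge-weight $b:\mathbb{N}_0\times\mathbb{N}_0\to[0,\infty)$ with $b(x,y)>0$ if and only if $|x-y|=1$, and a measure $m:\mathbb{N}_0\to(0,\infty)$. All functions are real-valued. $C_c(\mathbb{N}_0)$ is the space of finitely supported functions $\mathbb{N}_0\to\mathbb{R}$, and $\ell^2(\mathbb{N}_0,m)$ is the real Hilbert space of $f:\mathbb{N}_0\to\mathbb{R}$ with $\sum_x f(x)^2m(x)<\infty$, with inner product $\langle f,g\rangle=\sum_x f(x)g(x)m(x)$. The formal Laplacian acts on all functions $f:\mathbb{N}_0\to\mathbb{R}$ by $$\Delta f(x)=\frac{1}{m(x)}\sum_{y\in\mathbb{N}_0}b(x,y)(f(x)-f(y)),$$ and $W$ acts by multiplication, $(Wf)(x)=W(x)f(x)$. The Schr\"odinger operator $L_c+W$ is the restriction of $\Delta+W$ to the dense domain $C_c(\mathbb{N}_0)\subseteq\ell^2(\mathbb{N}_0,m)$; it is a symmetric operator in $\ell^2(\mathbb{N}_0,m)$. It is semi-bounded with lower bound $K\in\mathbb{R}$ if $\langle(\Delta+W)\varphi,\varphi\rangle\ge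 K\langle\varphi,\varphi\rangle$ for all $\varphi\in C_c(\mathbb{N}_0)$. A densely defined symmetric operator is essentially self-adjoint if its closure is self-adjoint (equivalently, it has a unique self-adjoint extension). Empty products equal $1$, and empty sums equal $0$. *)

theory Defs
  imports Complex_Main "HOL-Library.Extended_Nonnegative_Real"
begin

definition birth_death_chain :: "(nat \<Rightarrow> nat \<Rightarrow> real) \<Rightarrow> (nat \<Rightarrow> real) \<Rightarrow> bool" where
  "birth_death_chain b m \<longleftrightarrow>
     (\<forall>x y. b x y \<ge> 0) \<and> (\<forall>x y. b x y = b y x) \<and>
     (\<forall>x y. b x y > 0 \<longleftrightarrow> \<bar>int x - int y\<bar> = 1) \<and> (\<forall>x. m x > 0)"


section \<open>Unbounded operators in a weighted sequence space\<close>

text \<open>The space \<open>l\<^sup>2(\<nat>, m)\<close> depends on the weight \<open>m\<close>, so it is a set of functions rather than a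
  type. All \<open>m\<close> below are meant to be strictly positive; then a function of norm \<open>0\<close> is zero.\<close>

definition l2 :: "(nat \<Rightarrow> real) \<Rightarrow> (nat \<Rightarrow> real) set" where
  "l2 m = {f. summable (\<lambda>x. (f x)\<^sup>2 * m x)}"

definition l2_inner :: "(nat \<Rightarrow> real) \<Rightarrow> (nat \<Rightarrow> real) \<Rightarrow> (nat \<Rightarrow> real) \<Rightarrow> real" where
  "l2_inner m f g = (\<Sum>x. f x * g x * m x)"

definition l2_norm :: "(nat \<Rightarrow> real) \<Rightarrow> (nat \<Rightarrow> real) \<Rightarrow> real" where
  "l2_norm m f = sqrt (l2_inner m f f)"

text \<open>An operator with domain \<open>D\<close> is represented by its graph \<open>{(f, A f) | f \<in> D}\<close>.\<close>

type_synonym graph = "((nat \<Rightarrow> real) \<times> (nat \<Rightarrow> real)) set"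

definition linear_operator :: "(nat \<Rightarrow> real) \<Rightarrow> graph \<Rightarrow> bool" where
  "linear_operator m A \<longleftrightarrow>
     A \<subseteq> l2 m \<times> l2 m \<and> single_valued A \<and> (\<lambda>x. 0, \<lambda>x. 0) \<in> A \<and>
     (\<forall>(f, g)\<in>A. \<forall>(f', g')\<in>A. (\<lambda>x. f x + f' x, \<lambda>x. g x + g' x) \<in> A) \<and>
     (\<forall>a. \<forall>(f, g)\<in>A. (\<lambda>x. a * f x, \<lambda>x. a * g x) \<in> A)"

definition densely_defined :: "(nat \<Rightarrow> real) \<Rightarrow> graph \<Rightarrow> bool" where
  "densely_defined m A \<longleftrightarrow>
     Domain A \<subseteq> l2 m \<and> (\<forall>f\<in>l2 m. \<forall>\<epsilon>>0. \<exists>g\<in>Domain A. l2_norm m (\<lambda>x. f x - g x) < \<epsilon>)"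

definition symmetric :: "(nat \<Rightarrow> real) \<Rightarrow> graph \<Rightarrow> bool" where
  "symmetric m A \<longleftrightarrow> (\<forall>(f, g)\<in>A. \<forall>(f', g')\<in>A. l2_inner m g f' = l2_inner m f g')"

definition semibounded :: "(nat \<Rightarrow> real) \<Rightarrow> graph \<Rightarrow> real \<Rightarrow> bool" where
  "semibounded m A K \<longleftrightarrow> (\<forall>(f, g)\<in>A. l2_inner m g f \<ge> K * l2_inner m f f)"

definition l2_adjoint :: "(nat \<Rightarrow> real) \<Rightarrow> graph \<Rightarrow> graph" where
  "l2_adjoint m A =
     {(u, v) \<in> l2 m \<times> l2 m. \<forall>(f, g)\<in>A. l2_inner m g u = l2_inner m f v}"

text \<open>The closure of an operator is the operator whose graph is the closure of its graph in
  \<open>l\<^sup>2(\<nat>, m) \<times> l\<^sup>2(\<nat>, m)\<close>.\<close>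

definition l2_closure :: "(nat \<Rightarrow> real) \<Rightarrow> graph \<Rightarrow> graph" where
  "l2_closure m A =
     {(u, v) \<in> l2 m \<times> l2 m. \<exists>F G. (\<forall>n::nat. (F n, G n) \<in> A) \<and>
        (\<lambda>n. l2_norm m (\<lambda>x. F n x - u x)) \<longlonglongrightarrow> 0 \<and>
        (\<lambda>n. l2_norm m (\<lambda>x. G n x - v x)) \<longlonglongrightarrow> 0}"

text \<open>If the domain is dense, the adjoint is automatically linear and single-valued, so equality
  of graphs suffices.\<close>

definition self_adjoint :: "(nat \<Rightarrow> real) \<Rightarrow> graph \<Rightarrow> bool" where
  "self_adjoint m A \<longleftrightarrow> densely_defined m A \<and> l2_adjoint m A = A"

definition essentially_self_adjoint :: "(nat \<Rightarrow> real) \<Rightarrow> graph \<Rightarrow> bool" where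
  "essentially_self_adjoint m A \<longleftrightarrow>
     linear_operator m A \<and> densely_defined m A \<and> symmetric m A \<and> self_adjoint m (l2_closure m A)"


section \<open>The Schroedinger operator\<close>

definition Cc :: "(nat \<Rightarrow> real) set" where
  "Cc = {\<phi>. finite {x. \<phi> x \<noteq> 0}}"

text \<open>On a birth-death chain the series below has at most two nonzero terms.\<close>

definition laplacian ::
    "(nat \<Rightarrow> nat \<Rightarrow> real) \<Rightarrow> (nat \<Rightarrow> real) \<Rightarrow> (nat \<Rightarrow> real) \<Rightarrow> nat \<Rightarrow> real" where
  "laplacian b m f x = 1 / m x * (\<Sum>y. b x y * (f x - f y))"

text \<open>The graph of \<open>L\<^sub>c + W\<close>:\<close>

definition schroedinger ::
    "(nat \<Rightarrow> nat \<Rightarrow> real) \<Rightarrow> (nat \<Rightarrow> real) \<Rightarrow> (nat \<Rightarrow> real) \<Rightarrow> graph" where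
  "schroedinger b m W = {(\<phi>, \<lambda>x. laplacian b m \<phi> x + W x * \<phi> x) | \<phi>. \<phi> \<in> Cc}"


section \<open>The coefficients \<open>\<alpha>\<^sub>k\<close> and \<open>\<beta>\<^sub>k\<close>\<close>

definition Theta ::
    "(nat \<Rightarrow> nat \<Rightarrow> real) \<Rightarrow> (nat \<Rightarrow> real) \<Rightarrow> (nat \<Rightarrow> real) \<Rightarrow> real \<Rightarrow> real" where
  "Theta b m W lam = 1 + (W 0 - lam) * m 0 / b 0 1"

text \<open>Tuples \<open>(\<ell>\<^sub>1, \<dots>, \<ell>\<^sub>r)\<close> are lists, so \<open>\<ell>\<^sub>i\<close> is \<open>ls ! (i - 1)\<close>.\<close>

definition tuples :: "nat \<Rightarrow> nat \<Rightarrow> int list set" where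
  "tuples r s = {ls. length ls = r \<and> set ls \<subseteq> {1, 2} \<and> sum_list ls = int s}"

definition c_idx :: "nat \<Rightarrow> int list \<Rightarrow> nat \<Rightarrow> int" where
  "c_idx k ls i = int k - (\<Sum>n=1..i. ls ! (n - 1))"

text \<open>The index \<open>c\<close> is an integer: in \<open>\<beta>\<^sub>k\<close> the last one equals \<open>-1\<close>. It only occurs there together
  with \<open>\<ell>\<^sub>r = 2\<close>, hence in \<open>factor2\<close>; in \<open>factor1\<close> always \<open>c \<ge> 0\<close>. So \<open>nat\<close> never truncates.\<close>

definition factor1 ::
    "(nat \<Rightarrow> nat \<Rightarrow> real) \<Rightarrow> (nat \<Rightarrow> real) \<Rightarrow> (nat \<Rightarrow> real) \<Rightarrow> real \<Rightarrow> int \<Rightarrow> real" where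
  "factor1 b m W lam c =
     1 + (b (nat c) (nat (c + 1)) + (W (nat (c + 1)) - lam) * m (nat (c + 1)))
           / b (nat (c + 1)) (nat (c + 2))"

definition factor2 :: "(nat \<Rightarrow> nat \<Rightarrow> real) \<Rightarrow> int \<Rightarrow> real" where
  "factor2 b c = (- b (nat (c + 1)) (nat (c + 2))) / b (nat (c + 2)) (nat (c + 3))"

definition tuple_weight ::
    "(nat \<Rightarrow> nat \<Rightarrow> real) \<Rightarrow> (nat \<Rightarrow> real) \<Rightarrow> (nat \<Rightarrow> real) \<Rightarrow> real \<Rightarrow> nat \<Rightarrow> int list \<Rightarrow> real" where
  "tuple_weight b m W lam k ls =
     (\<Prod>i\<in>{i\<in>{1..length ls}. ls ! (i - 1) = 1}. factor1 b m W lam (c_idx k ls i)) *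
     (\<Prod>i\<in>{i\<in>{1..length ls}. ls ! (i - 1) = 2}. factor2 b (c_idx k ls i))"

definition alpha ::
    "(nat \<Rightarrow> nat \<Rightarrow> real) \<Rightarrow> (nat \<Rightarrow> real) \<Rightarrow> (nat \<Rightarrow> real) \<Rightarrow> real \<Rightarrow> nat \<Rightarrow> real" where
  "alpha b m W lam k =
     (if k = 0 then Theta b m W lam
      else Theta b m W lam * (\<Sum>r=1..k. \<Sum>ls\<in>tuples r k. tuple_weight b m W lam k ls))"

definition beta ::
    "(nat \<Rightarrow> nat \<Rightarrow> real) \<Rightarrow> (nat \<Rightarrow> real) \<Rightarrow> (nat \<Rightarrow> real) \<Rightarrow> real \<Rightarrow> nat \<Rightarrow> real" where
  "beta b m W lam k =
     (if k = 0 then 0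
      else (\<Sum>r=1..k+1. \<Sum>ls\<in>{ls\<in>tuples r (k + 1). ls ! (r - 1) = 2}. tuple_weight b m W lam k ls))"

end

theory Submission
  imports Defs "HOL-Analysis.Convex"
begin

text \<open>
  Write \<open>H = \<Delta> + W\<close> for the formal operator on all sequences. Because only neighbouring points
  interact, \<open>(H - \<lambda>) u = 0\<close> is a three-term recursion: the equation at \<open>x\<close> determines \<open>u (x + 1)\<close>
  from \<open>u x\<close> and \<open>u (x - 1)\<close>, and the equation at \<open>0\<close> determines \<open>u 1 = \<Theta> * u 0\<close>. Hence the solution
  space is spanned by the solution \<open>u\<close> with \<open>u 0 = 1\<close>. Unrolling the recursion expresses \<open>u (k + 1)\<close>
  as a sum over the ways to walk down from \<open>k\<close> by steps \<open>1\<close> and \<open>2\<close>; the walks that reach the value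
  \<open>u 1\<close> contribute \<open>\<alpha>\<^sub>k\<close> and those that reach the value \<open>u 0\<close>, necessarily by a last step \<open>2\<close>,
  contribute \<open>\<beta>\<^sub>k\<close>. So \<open>u (k + 1) = \<alpha>\<^sub>k + \<beta>\<^sub>k\<close> (lemma \<open>fundamental_solution\<close>), and the series in the
  theorem diverges exactly if \<open>u\<close> is not in \<open>l\<^sup>2\<close>.

  It remains to show, for every \<open>\<lambda> < K\<close>, that \<open>L\<^sub>c + W\<close> is essentially self-adjoint if and only if
  \<open>u \<notin> l\<^sup>2\<close> (\<open>essentially_self_adjoint_iff\<close>). By Green's formula the adjoint of \<open>A = L\<^sub>c + W\<close> is \<open>H\<close>
  on its maximal domain. Semi-boundedness gives the coercive estimate
  \<open>(K - \<lambda>) \<parallel>\<phi>\<parallel> \<le> \<parallel>(H - \<lambda>) \<phi>\<parallel>\<close> on \<open>C\<^sub>c\<close>, which survives in the closure.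

  If \<open>u \<in> l\<^sup>2\<close>, then \<open>u\<close> is an eigenvector of the adjoint for the eigenvalue \<open>\<lambda>\<close>, which by coercivity
  the closure cannot have (\<open>closure_no_eigenvector\<close>); so closure and adjoint differ.

  If \<open>u \<notin> l\<^sup>2\<close>, the range of \<open>A - \<lambda>\<close> is dense (\<open>dense_range\<close>), for a concrete reason:
  a sequence supported in \<open>{0..n}\<close> is in that range as soon as it is orthogonal to \<open>u\<close>
  (\<open>orthogonal_in_range\<close>), and one achieves orthogonality by subtracting a multiple of the truncation
  of \<open>u\<close> to \<open>{0..n}\<close>. The norm of that truncation is unbounded in \<open>n\<close>, so the correction becomes
  arbitrarily small. Given \<open>f\<close> in the domain of the adjoint, choose \<open>\<phi>\<^sub>n \<in> C\<^sub>c\<close> with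
  \<open>(H - \<lambda>) \<phi>\<^sub>n \<longlonglongrightarrow> (H - \<lambda>) f\<close>. By coercivity \<open>\<phi>\<^sub>n\<close> converges to some \<open>h \<in> l\<^sup>2\<close>, and \<open>f - h\<close> is a
  multiple of \<open>u\<close> that lies in \<open>l\<^sup>2\<close>, hence zero. So \<open>f\<close> is in the domain of the closure
  (\<open>closure_eq_adjoint\<close>).
\<close>

section \<open>The weighted sequence space\<close>

locale weight =
  fixes m :: "nat \<Rightarrow> real"
  assumes m_pos: "0 < m x"
begin

lemma m_nonneg [simp]: "0 \<le> m x"
  using m_pos less_imp_le by blast

lemma l2_mult_summable:
  assumes "f \<in> l2 m" "g \<in> l2 m"
  shows "summable (\<lambda>x. f x * g x * m x)"
proof (rule summable_comparison_test')
  show "summable (\<lambda>x. (f x)\<^sup>2 * m x + (g x)\<^sup>2 * m x)"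
    using assms by (auto simp: l2_def intro: summable_add)
  fix x
  have "\<bar>f x * g x\<bar> \<le> (f x)\<^sup>2 + (g x)\<^sup>2"
  proof -
    have "2 * \<bar>f x\<bar> * \<bar>g x\<bar> \<le> \<bar>f x\<bar>\<^sup>2 + \<bar>g x\<bar>\<^sup>2"
      by (rule sum_squares_bound)
    moreover have "0 \<le> \<bar>f x\<bar> * \<bar>g x\<bar>" by simp
    ultimately show ?thesis unfolding abs_mult power2_abs by linarith
  qed
  then have "\<bar>f x * g x\<bar> * m x \<le> ((f x)\<^sup>2 + (g x)\<^sup>2) * m x"
    by (intro mult_right_mono) auto
  then show "norm (f x * g x * m x) \<le> (f x)\<^sup>2 * m x + (g x)\<^sup>2 * m x"
    by (simp add: abs_mult algebra_simps)
qed

lemma l2_lincomb: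
  assumes "f \<in> l2 m" "g \<in> l2 m"
  shows "(\<lambda>x. a * f x + c * g x) \<in> l2 m"
proof -
  have "summable (\<lambda>x. a\<^sup>2 * ((f x)\<^sup>2 * m x) + 2 * a * c * (f x * g x * m x) + c\<^sup>2 * ((g x)\<^sup>2 * m x))"
    using assms l2_mult_summable[OF assms]
    by (intro summable_add summable_mult) (auto simp: l2_def)
  then show ?thesis
    by (simp add: l2_def power2_eq_square algebra_simps)
qed

lemma l2_scale: "f \<in> l2 m \<Longrightarrow> (\<lambda>x. a * f x) \<in> l2 m"
  using l2_lincomb[of f f a 0] by simp

lemma l2_add: "f \<in> l2 m \<Longrightarrow> g \<in> l2 m \<Longrightarrow> (\<lambda>x. f x + g x) \<in> l2 m"
  using l2_lincomb[of f g 1 1] by simp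

lemma l2_diff: "f \<in> l2 m \<Longrightarrow> g \<in> l2 m \<Longrightarrow> (\<lambda>x. f x - g x) \<in> l2 m"
  using l2_lincomb[of f g 1 "-1"] by simp

lemma l2_inner_commute: "l2_inner m f g = l2_inner m g f"
  by (simp add: l2_inner_def mult.commute)

lemma l2_inner_lincomb:
  assumes "f \<in> l2 m" "g \<in> l2 m" "h \<in> l2 m"
  shows "l2_inner m (\<lambda>x. a * f x + c * g x) h = a * l2_inner m f h + c * l2_inner m g h"
proof -
  have "l2_inner m (\<lambda>x. a * f x + c * g x) h
      = (\<Sum>x. a * (f x * h x * m x) + c * (g x * h x * m x))"
    by (simp add: l2_inner_def algebra_simps)
  also have "\<dots> = a * l2_inner m f h + c * l2_inner m g h"
    using l2_mult_summable[OF assms(1,3)] l2_mult_summable[OF assms(2,3)]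
    by (simp add: l2_inner_def suminf_add[symmetric] suminf_mult summable_mult)
  finally show ?thesis .
qed

lemma l2_inner_add:
  assumes "f \<in> l2 m" "g \<in> l2 m" "h \<in> l2 m"
  shows "l2_inner m (\<lambda>x. f x + g x) h = l2_inner m f h + l2_inner m g h"
  using l2_inner_lincomb[OF assms, of 1 1] by simp

lemma l2_inner_diff:
  assumes "f \<in> l2 m" "g \<in> l2 m" "h \<in> l2 m"
  shows "l2_inner m (\<lambda>x. f x - g x) h = l2_inner m f h - l2_inner m g h"
  using l2_inner_lincomb[OF assms, of 1 "-1"] by simp

lemma l2_inner_scale:
  assumes "f \<in> l2 m" "h \<in> l2 m"
  shows "l2_inner m (\<lambda>x. a * f x) h = a * l2_inner m f h"
  using l2_inner_lincomb[OF assms(1,1,2), of a 0] by simp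

lemma sum_square_le_l2_inner:
  assumes "f \<in> l2 m"
  shows "(\<Sum>x<n. (f x)\<^sup>2 * m x) \<le> l2_inner m f f"
  unfolding l2_inner_def power2_eq_square[symmetric]
  using assms by (intro sum_le_suminf) (auto simp: l2_def)

lemma l2_inner_self_nonneg: "f \<in> l2 m \<Longrightarrow> 0 \<le> l2_inner m f f"
  using sum_square_le_l2_inner[of f 0] by simp

lemma l2_norm_nonneg: "f \<in> l2 m \<Longrightarrow> 0 \<le> l2_norm m f"
  by (simp add: l2_norm_def l2_inner_self_nonneg)

lemma l2_norm_square: "f \<in> l2 m \<Longrightarrow> (l2_norm m f)\<^sup>2 = l2_inner m f f"
  by (simp add: l2_norm_def l2_inner_self_nonneg)

lemma l2_norm_minus_commute: "l2_norm m (\<lambda>x. f x - g x) = l2_norm m (\<lambda>x. g x - f x)"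
  unfolding l2_norm_def l2_inner_def
  by (simp add: power2_eq_square[symmetric] power2_commute)

lemma l2_norm_scale: "f \<in> l2 m \<Longrightarrow> l2_norm m (\<lambda>x. a * f x) = \<bar>a\<bar> * l2_norm m f"
  unfolding l2_norm_def
  by (simp add: l2_inner_scale l2_inner_commute[of f "\<lambda>x. a * f x"] l2_scale real_sqrt_mult
      flip: mult.assoc)

lemma abs_le_l2_norm:
  assumes "f \<in> l2 m"
  shows "\<bar>f x\<bar> * sqrt (m x) \<le> l2_norm m f"
proof -
  have "(f x)\<^sup>2 * m x \<le> (\<Sum>y<Suc x. (f y)\<^sup>2 * m y)"
    by (simp add: sum_nonneg)
  also have "\<dots> \<le> l2_inner m f f"
    by (rule sum_square_le_l2_inner[OF assms])
  finally show ?thesis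
    unfolding l2_norm_def by (metis real_sqrt_abs real_sqrt_le_mono real_sqrt_mult)
qed

lemma l2_cauchy_schwarz:
  assumes f: "f \<in> l2 m" and g: "g \<in> l2 m"
  shows "\<bar>l2_inner m f g\<bar> \<le> l2_norm m f * l2_norm m g"
proof -
  have le: "(\<Sum>x<n. f x * g x * m x)\<^sup>2 \<le> l2_inner m f f * l2_inner m g g" for n
  proof -
    have "(\<Sum>x<n. f x * g x * m x)\<^sup>2 = (\<Sum>x<n. (f x * sqrt (m x)) * (g x * sqrt (m x)))\<^sup>2"
      by (simp add: mult_ac)
    also have "\<dots> \<le> (\<Sum>x<n. (f x * sqrt (m x))\<^sup>2) * (\<Sum>x<n. (g x * sqrt (m x))\<^sup>2)"
      by (rule Cauchy_Schwarz_ineq_sum)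
    also have "\<dots> = (\<Sum>x<n. (f x)\<^sup>2 * m x) * (\<Sum>x<n. (g x)\<^sup>2 * m x)"
      by (simp add: power_mult_distrib)
    also have "\<dots> \<le> l2_inner m f f * l2_inner m g g"
      by (intro mult_mono sum_square_le_l2_inner sum_nonneg l2_inner_self_nonneg f g) simp_all
    finally show ?thesis .
  qed
  have "(\<lambda>n. (\<Sum>x<n. f x * g x * m x)\<^sup>2) \<longlonglongrightarrow> (l2_inner m f g)\<^sup>2"
    unfolding l2_inner_def by (intro tendsto_power summable_LIMSEQ l2_mult_summable f g)
  then have "(l2_inner m f g)\<^sup>2 \<le> l2_inner m f f * l2_inner m g g"
    by (rule LIMSEQ_le_const2) (use le in auto)
  also have "\<dots> = (l2_norm m f * l2_norm m g)\<^sup>2"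
    by (simp add: power_mult_distrib l2_norm_square f g)
  finally show ?thesis
    using abs_le_square_iff[of "l2_inner m f g" "l2_norm m f * l2_norm m g"]
      l2_norm_nonneg[OF f] l2_norm_nonneg[OF g] by (metis abs_of_nonneg mult_nonneg_nonneg)
qed

lemma l2_norm_triangle:
  assumes f: "f \<in> l2 m" and g: "g \<in> l2 m"
  shows "l2_norm m (\<lambda>x. f x + g x) \<le> l2_norm m f + l2_norm m g"
proof (rule power2_le_imp_le)
  have "(l2_norm m (\<lambda>x. f x + g x))\<^sup>2
      = l2_inner m f f + 2 * l2_inner m f g + l2_inner m g g"
    using f g l2_add[OF f g] l2_inner_add[OF f g f] l2_inner_add[OF f g g]
    by (simp add: l2_norm_square l2_inner_add l2_inner_commute[of f "\<lambda>x. f x + g x"]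
        l2_inner_commute[of g "\<lambda>x. f x + g x"] l2_inner_commute[of g f])
  also have "\<dots> \<le> (l2_norm m f + l2_norm m g)\<^sup>2"
    using l2_cauchy_schwarz[OF f g] by (simp add: power2_sum l2_norm_square f g)
  finally show "(l2_norm m (\<lambda>x. f x + g x))\<^sup>2 \<le> (l2_norm m f + l2_norm m g)\<^sup>2" .
qed (simp add: l2_norm_nonneg f g)

lemma l2_norm_triangle_diff:
  assumes "f \<in> l2 m" "g \<in> l2 m" "h \<in> l2 m"
  shows "l2_norm m (\<lambda>x. f x - h x) \<le> l2_norm m (\<lambda>x. f x - g x) + l2_norm m (\<lambda>x. g x - h x)"
  using l2_norm_triangle[OF l2_diff[OF assms(1,2)] l2_diff[OF assms(2,3)]] by simp

lemma l2_inner_tendsto: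
  assumes F: "\<And>n. F n \<in> l2 m" and f: "f \<in> l2 m" and h: "h \<in> l2 m"
    and lim: "(\<lambda>n. l2_norm m (\<lambda>x. F n x - f x)) \<longlonglongrightarrow> 0"
  shows "(\<lambda>n. l2_inner m (F n) h) \<longlonglongrightarrow> l2_inner m f h"
proof (rule LIM_zero_cancel, rule tendsto_0_le[OF lim])
  have "norm (l2_inner m (F n) h - l2_inner m f h)
      \<le> norm (l2_norm m (\<lambda>x. F n x - f x)) * l2_norm m h" for n
    using l2_cauchy_schwarz[OF l2_diff[OF F[of n] f] h] l2_norm_nonneg[OF l2_diff[OF F[of n] f]]
    by (simp add: l2_inner_diff F f h)
  then show "\<forall>\<^sub>F n in sequentially. norm (l2_inner m (F n) h - l2_inner m f h)
      \<le> norm (l2_norm m (\<lambda>x. F n x - f x)) * l2_norm m h"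
    by simp
qed

text \<open>Evaluation at a point is continuous because \<open>m x > 0\<close>, so a Cauchy sequence converges pointwise;
  a Fatou argument, letting \<open>q\<close> tend to infinity in finite partial sums of \<open>\<parallel>F p - F q\<parallel>\<^sup>2\<close>, turns this
  into convergence in norm. The pointwise limits are part of the conclusion because
  \<open>\<Delta> + W\<close> is a local operator and passes to them without any domain question.\<close>

lemma l2_complete:
  assumes F: "\<And>n. F n \<in> l2 m"
    and cauchy: "\<And>\<epsilon>. 0 < \<epsilon> \<Longrightarrow> \<exists>N. \<forall>p\<ge>N. \<forall>q\<ge>N. l2_norm m (\<lambda>x. F p x - F q x) < \<epsilon>"
  obtains h where "h \<in> l2 m" "\<And>x. (\<lambda>n. F n x) \<longlonglongrightarrow> h x"
    "(\<lambda>n. l2_norm m (\<lambda>x. F n x - h x)) \<longlonglongrightarrow> 0"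
proof -
  have "convergent (\<lambda>n. F n x)" for x
  proof (rule Cauchy_convergent, rule CauchyI)
    fix e :: real assume "0 < e"
    then have "0 < e * sqrt (m x)" using m_pos[of x] by simp
    then obtain N where N: "\<forall>p\<ge>N. \<forall>q\<ge>N. l2_norm m (\<lambda>x. F p x - F q x) < e * sqrt (m x)"
      using cauchy by blast
    have "norm (F p x - F q x) < e" if "N \<le> p" "N \<le> q" for p q
    proof -
      have "\<bar>F p x - F q x\<bar> * sqrt (m x) < e * sqrt (m x)"
        using abs_le_l2_norm[OF l2_diff[OF F[of p] F[of q]], of x] N that by fastforce
      then show ?thesis using m_pos[of x] by (simp add: mult_less_cancel_right)
    qed
    then show "\<exists>M. \<forall>p\<ge>M. \<forall>q\<ge>M. norm (F p x - F q x) < e" by blast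
  qed
  then obtain h where h: "\<And>x. (\<lambda>n. F n x) \<longlonglongrightarrow> h x"
    unfolding convergent_def by metis
  have bound: "(\<lambda>x. F p x - h x) \<in> l2 m \<and> l2_norm m (\<lambda>x. F p x - h x) \<le> \<epsilon>"
    if "0 < \<epsilon>" and N: "\<forall>p\<ge>N. \<forall>q\<ge>N. l2_norm m (\<lambda>x. F p x - F q x) < \<epsilon>" and "N \<le> p"
    for \<epsilon> N p
  proof -
    have le: "(\<Sum>x<n. (F p x - h x)\<^sup>2 * m x) \<le> \<epsilon>\<^sup>2" for n
    proof (rule LIMSEQ_le_const2)
      show "(\<lambda>q. \<Sum>x<n. (F p x - F q x)\<^sup>2 * m x) \<longlonglongrightarrow> (\<Sum>x<n. (F p x - h x)\<^sup>2 * m x)"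
        by (intro tendsto_intros h)
      have "(\<Sum>x<n. (F p x - F q x)\<^sup>2 * m x) \<le> \<epsilon>\<^sup>2" if "N \<le> q" for q
      proof -
        have mem: "(\<lambda>x. F p x - F q x) \<in> l2 m" by (intro l2_diff F)
        have "(\<Sum>x<n. (F p x - F q x)\<^sup>2 * m x) \<le> (l2_norm m (\<lambda>x. F p x - F q x))\<^sup>2"
          using sum_square_le_l2_inner[OF mem] l2_norm_square[OF mem] by simp
        also have "\<dots> \<le> \<epsilon>\<^sup>2"
          using N that \<open>N \<le> p\<close> by (intro power_mono l2_norm_nonneg[OF mem] less_imp_le) simp
        finally show ?thesis .
      qed
      then show "\<exists>N. \<forall>q\<ge>N. (\<Sum>x<n. (F p x - F q x)\<^sup>2 * m x) \<le> \<epsilon>\<^sup>2" by blast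
    qed
    have s: "summable (\<lambda>x. (F p x - h x)\<^sup>2 * m x)"
      by (intro summableI_nonneg_bounded[OF _ le]) simp
    then have mem: "(\<lambda>x. F p x - h x) \<in> l2 m" by (simp add: l2_def)
    have "l2_inner m (\<lambda>x. F p x - h x) (\<lambda>x. F p x - h x) \<le> \<epsilon>\<^sup>2"
      using suminf_le_const[OF s le] by (simp add: l2_inner_def power2_eq_square)
    then have "l2_norm m (\<lambda>x. F p x - h x) \<le> \<epsilon>"
      using \<open>0 < \<epsilon>\<close> by (simp add: l2_norm_def real_le_lsqrt)
    with mem show ?thesis by simp
  qed
  obtain N where "\<forall>p\<ge>N. \<forall>q\<ge>N. l2_norm m (\<lambda>x. F p x - F q x) < 1"
    using cauchy[of 1] by auto
  then have "(\<lambda>x. F N x - h x) \<in> l2 m" using bound[of 1 N N] by simp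
  then have "h \<in> l2 m" using l2_diff[OF F[of N]] by fastforce
  moreover have "(\<lambda>n. l2_norm m (\<lambda>x. F n x - h x)) \<longlonglongrightarrow> 0"
  proof (rule LIMSEQ_I)
    fix r :: real assume "0 < r"
    then obtain N where "\<forall>p\<ge>N. \<forall>q\<ge>N. l2_norm m (\<lambda>x. F p x - F q x) < r / 2"
      using cauchy[of "r / 2"] by auto
    then have "l2_norm m (\<lambda>x. F p x - h x) \<le> r / 2" if "N \<le> p" for p
      using bound[of "r / 2" N p] \<open>0 < r\<close> that by simp
    then have "norm (l2_norm m (\<lambda>x. F p x - h x) - 0) < r" if "N \<le> p" for p
      using that \<open>0 < r\<close> l2_norm_nonneg[OF l2_diff[OF F[of p] \<open>h \<in> l2 m\<close>]] by fastforce
    then show "\<exists>no. \<forall>n\<ge>no. norm (l2_norm m (\<lambda>x. F n x - h x) - 0) < r" by blast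
  qed
  ultimately show ?thesis using h that by blast
qed

lemma Cc_iff: "\<phi> \<in> Cc \<longleftrightarrow> (\<exists>N. \<forall>x\<ge>N. \<phi> x = 0)"
proof
  assume "\<phi> \<in> Cc"
  then obtain N where "\<forall>x\<in>{x. \<phi> x \<noteq> 0}. x < N"
    unfolding Cc_def using finite_nat_set_iff_bounded by blast
  then show "\<exists>N. \<forall>x\<ge>N. \<phi> x = 0" by (intro exI[of _ N]) force
next
  assume "\<exists>N. \<forall>x\<ge>N. \<phi> x = 0"
  then obtain N where "\<forall>x\<ge>N. \<phi> x = 0" by blast
  then have "{x. \<phi> x \<noteq> 0} \<subseteq> {..<N}" by (force simp: not_le[symmetric])
  then show "\<phi> \<in> Cc" unfolding Cc_def using finite_subset by blast
qed

lemma Cc_lincomb: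
  assumes "\<phi> \<in> Cc" "\<psi> \<in> Cc"
  shows "(\<lambda>x. a * \<phi> x + c * \<psi> x) \<in> Cc"
proof -
  obtain M N where "\<forall>x\<ge>M. \<phi> x = 0" "\<forall>x\<ge>N. \<psi> x = 0"
    using assms by (auto simp: Cc_iff)
  then have "\<forall>x\<ge>max M N. a * \<phi> x + c * \<psi> x = 0" by simp
  then show ?thesis unfolding Cc_iff by blast
qed

lemma Cc_subset_l2: "\<phi> \<in> Cc \<Longrightarrow> \<phi> \<in> l2 m"
  unfolding l2_def Cc_def by (auto intro!: summable_finite)

lemma l2_inner_finite_support:
  assumes "\<And>x. N \<le> x \<Longrightarrow> f x = 0"
  shows "l2_inner m f g = (\<Sum>x<N. f x * g x * m x)"
  unfolding l2_inner_def by (rule suminf_finite) (use assms in \<open>auto simp: not_less\<close>)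

lemma l2_truncation:
  assumes f: "f \<in> l2 m" and "0 < \<epsilon>"
  obtains N where "l2_norm m (\<lambda>x. f x - (if x < N then f x else 0)) < \<epsilon>"
proof -
  let ?a = "\<lambda>x. (f x)\<^sup>2 * m x"
  have s: "summable ?a" using f by (simp add: l2_def)
  obtain N where "norm (\<Sum>x. ?a (x + N)) < \<epsilon>\<^sup>2"
    using suminf_exist_split[OF _ s, of "\<epsilon>\<^sup>2"] \<open>0 < \<epsilon>\<close> by auto
  then have tail: "(\<Sum>x. ?a (x + N)) < \<epsilon>\<^sup>2" by simp
  let ?t = "\<lambda>x. f x - (if x < N then f x else 0)"
  have "summable (\<lambda>x. (?t x)\<^sup>2 * m x)"
    by (subst summable_iff_shift[of _ N, symmetric]) (use s summable_iff_shift[of ?a N] in auto)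
  then have "l2_inner m ?t ?t = (\<Sum>x. (?t (x + N))\<^sup>2 * m (x + N))"
    unfolding l2_inner_def power2_eq_square[symmetric]
    by (subst suminf_split_initial_segment[of _ N]) auto
  then have "l2_inner m ?t ?t < \<epsilon>\<^sup>2" using tail by simp
  then have "l2_norm m ?t < \<epsilon>"
    unfolding l2_norm_def using \<open>0 < \<epsilon>\<close> by (simp add: real_less_lsqrt)
  then show ?thesis by (rule that)
qed

lemma Cc_dense:
  assumes "f \<in> l2 m" "0 < \<epsilon>"
  shows "\<exists>\<phi>\<in>Cc. l2_norm m (\<lambda>x. f x - \<phi> x) < \<epsilon>"
proof -
  obtain N where N: "l2_norm m (\<lambda>x. f x - (if x < N then f x else 0)) < \<epsilon>"
    using l2_truncation[OF assms] .
  moreover have "(\<lambda>x. if x < N then f x else 0) \<in> Cc"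
    unfolding Cc_iff by (rule exI[of _ N]) simp
  ultimately show ?thesis by (rule rev_bexI[rotated])
qed

section \<open>Adjoint and closure\<close>

lemma l2_closureE:
  assumes "(f, g) \<in> l2_closure m A"
  obtains F G where "\<And>n::nat. (F n, G n) \<in> A"
    "(\<lambda>n. l2_norm m (\<lambda>x. F n x - f x)) \<longlonglongrightarrow> 0"
    "(\<lambda>n. l2_norm m (\<lambda>x. G n x - g x)) \<longlonglongrightarrow> 0"
    "f \<in> l2 m" "g \<in> l2 m"
proof -
  have fg: "f \<in> l2 m" "g \<in> l2 m" and
    ex: "\<exists>F G. (\<forall>n::nat. (F n, G n) \<in> A) \<and>
      (\<lambda>n. l2_norm m (\<lambda>x. F n x - f x)) \<longlonglongrightarrow> 0 \<and>
      (\<lambda>n. l2_norm m (\<lambda>x. G n x - g x)) \<longlonglongrightarrow> 0"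
    using assms by (simp_all add: l2_closure_def)
  from ex show ?thesis
  proof (elim exE conjE)
    fix F G
    assume "\<forall>n::nat. (F n, G n) \<in> A"
      "(\<lambda>n. l2_norm m (\<lambda>x. F n x - f x)) \<longlonglongrightarrow> 0"
      "(\<lambda>n. l2_norm m (\<lambda>x. G n x - g x)) \<longlonglongrightarrow> 0"
    then show ?thesis using fg by (intro that[of F G]) simp_all
  qed
qed

lemma subset_l2_closure:
  assumes "A \<subseteq> l2 m \<times> l2 m"
  shows "A \<subseteq> l2_closure m A"
proof clarify
  fix f g assume "(f, g) \<in> A"
  then show "(f, g) \<in> l2_closure m A"
    using assms unfolding l2_closure_def mem_Collect_eq case_prod_conv
    by (intro conjI exI[of _ "\<lambda>n. f"] exI[of _ "\<lambda>n. g"]) (auto simp: l2_norm_def l2_inner_def)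
qed

text \<open>The defining identity of the adjoint is preserved under limits in the graph, because the inner
  product is continuous.\<close>

lemma l2_adjoint_closure:
  assumes A: "A \<subseteq> l2 m \<times> l2 m"
  shows "l2_adjoint m (l2_closure m A) = l2_adjoint m A"
proof
  show "l2_adjoint m (l2_closure m A) \<subseteq> l2_adjoint m A"
    using subset_l2_closure[OF A] unfolding l2_adjoint_def by blast
  show "l2_adjoint m A \<subseteq> l2_adjoint m (l2_closure m A)"
  proof clarify
    fix u v assume uv: "(u, v) \<in> l2_adjoint m A"
    then have mem: "u \<in> l2 m" "v \<in> l2 m" by (auto simp: l2_adjoint_def)
    have "l2_inner m g u = l2_inner m f v" if closure: "(f, g) \<in> l2_closure m A" for f g
    proof -
      obtain F G where FG: "\<And>n::nat. (F n, G n) \<in> A"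
        and lim: "(\<lambda>n. l2_norm m (\<lambda>x. F n x - f x)) \<longlonglongrightarrow> 0"
          "(\<lambda>n. l2_norm m (\<lambda>x. G n x - g x)) \<longlonglongrightarrow> 0"
        and fg: "f \<in> l2 m" "g \<in> l2 m"
        using closure by (rule l2_closureE) (rule that)
      have l2: "\<And>n. F n \<in> l2 m" "\<And>n. G n \<in> l2 m" using FG A by auto
      have "(\<lambda>n. l2_inner m (G n) u) \<longlonglongrightarrow> l2_inner m g u"
        using l2_inner_tendsto[OF l2(2) fg(2) mem(1) lim(2)] .
      moreover have "l2_inner m (G n) u = l2_inner m (F n) v" for n
        using uv FG[of n] by (auto simp: l2_adjoint_def)
      moreover have "(\<lambda>n. l2_inner m (F n) v) \<longlonglongrightarrow> l2_inner m f v"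
        using l2_inner_tendsto[OF l2(1) fg(1) mem(2) lim(1)] .
      ultimately show ?thesis by (simp add: LIMSEQ_unique)
    qed
    then show "(u, v) \<in> l2_adjoint m (l2_closure m A)"
      using mem by (auto simp: l2_adjoint_def)
  qed
qed

text \<open>Symmetry says \<open>A \<subseteq> A\<^sup>*\<close>. As \<open>A\<^sup>*\<close> is also the adjoint of the closure, each element of \<open>A\<close> pairs
  correctly with each element of the closure; read in the other direction, this is the claim.\<close>

lemma closure_subset_adjoint:
  assumes A: "A \<subseteq> l2 m \<times> l2 m" and "symmetric m A"
  shows "l2_closure m A \<subseteq> l2_adjoint m A"
proof -
  have "A \<subseteq> l2_adjoint m A"
    using assms by (fastforce simp: l2_adjoint_def symmetric_def)
  have "A \<subseteq> l2_adjoint m (l2_closure m A)"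
    using \<open>A \<subseteq> l2_adjoint m A\<close> by (simp add: l2_adjoint_closure[OF A])
  show ?thesis
  proof clarify
    fix u v assume uv: "(u, v) \<in> l2_closure m A"
    have "l2_inner m g u = l2_inner m f v" if "(f, g) \<in> A" for f g
    proof -
      have "l2_inner m v f = l2_inner m u g"
        using uv \<open>A \<subseteq> l2_adjoint m (l2_closure m A)\<close> that by (auto simp: l2_adjoint_def)
      then show ?thesis by (simp add: l2_inner_commute)
    qed
    then show "(u, v) \<in> l2_adjoint m A"
      using uv by (auto simp: l2_adjoint_def l2_closure_def)
  qed
qed

end

section \<open>Three-term operators on the half-line\<close>

text \<open>The hypotheses on a birth-death chain in the form in which they make \<open>\<Delta>\<close> a three-term operator.\<close>

locale birth_death = weight m for m +
  fixes b :: "nat \<Rightarrow> nat \<Rightarrow> real"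
  assumes b_sym: "b x y = b y x"
    and b_pos: "0 < b x (Suc x)"
    and b_zero: "\<bar>int x - int y\<bar> \<noteq> 1 \<Longrightarrow> b x y = 0"
begin

text \<open>The potential is an argument rather than a parameter of the locale: \<open>\<Delta> + W - \<lambda>\<close> is again of
  this form, with the potential \<open>W - \<lambda>\<close>.\<close>

definition schr :: "(nat \<Rightarrow> real) \<Rightarrow> (nat \<Rightarrow> real) \<Rightarrow> nat \<Rightarrow> real" where
  "schr V f x = laplacian b m f x + V x * f x"

lemma schr_0: "schr V f 0 = b 0 1 * (f 0 - f 1) / m 0 + V 0 * f 0"
proof -
  have "(\<Sum>y. b 0 y * (f 0 - f y)) = (\<Sum>y\<in>{1}. b 0 y * (f 0 - f y))"
    by (rule suminf_finite) (use b_zero[of 0] in auto)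
  then show ?thesis by (simp add: schr_def laplacian_def)
qed

lemma schr_Suc:
  "schr V f (Suc x) = (b x (Suc x) * (f (Suc x) - f x)
     + b (Suc x) (Suc (Suc x)) * (f (Suc x) - f (Suc (Suc x)))) / m (Suc x) + V (Suc x) * f (Suc x)"
proof -
  have "(\<Sum>y. b (Suc x) y * (f (Suc x) - f y))
      = (\<Sum>y\<in>{x, Suc (Suc x)}. b (Suc x) y * (f (Suc x) - f y))"
    by (rule suminf_finite) (use b_zero[of "Suc x"] in auto)
  then show ?thesis by (simp add: schr_def laplacian_def b_sym[of "Suc x" x])
qed

lemma schr_lincomb: "schr V (\<lambda>x. a * f x + c * g x) x = a * schr V f x + c * schr V g x"
  using m_pos[of 0] m_pos[of "Suc (x - 1)"]
  by (cases x) (simp_all add: schr_0 schr_Suc field_simps)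

lemma schr_diff: "schr V (\<lambda>x. f x - g x) x = schr V f x - schr V g x"
  using schr_lincomb[of V 1 f "-1" g x] by simp

lemma schr_potential_diff: "schr (\<lambda>x. V x - c) f x = schr V f x - c * f x"
  by (simp add: schr_def algebra_simps)

lemma schr_vanishes:
  assumes "\<And>x. N \<le> x \<Longrightarrow> f x = 0" "Suc N \<le> x"
  shows "schr V f x = 0"
  using assms by (cases x) (simp_all add: schr_Suc)

lemma schr_Cc: "\<phi> \<in> Cc \<Longrightarrow> schr V \<phi> \<in> Cc"
  unfolding Cc_iff using schr_vanishes by blast

lemma schr_tendsto:
  assumes "\<And>x. (\<lambda>n. F n x) \<longlonglongrightarrow> f x"
  shows "(\<lambda>n. schr V (F n) x) \<longlonglongrightarrow> schr V f x"
proof (cases x)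
  case 0
  show ?thesis
    unfolding 0 schr_0 by (intro tendsto_intros assms) (use m_pos[of 0] in simp)
next
  case (Suc y)
  show ?thesis
    unfolding Suc schr_Suc by (intro tendsto_intros assms) (use m_pos[of "Suc y"] in simp)
qed

text \<open>Summation by parts telescopes and leaves only the Wronskian of \<open>f\<close> and \<open>g\<close> at the right end.\<close>

lemma green_formula_partial:
  "(\<Sum>x<Suc N. schr V f x * g x * m x - f x * schr V g x * m x)
     = b N (Suc N) * (f N * g (Suc N) - f (Suc N) * g N)"
proof (induction N)
  case 0
  then show ?case using m_pos[of 0] by (simp add: schr_0 field_simps)
next
  case (Suc N)
  show ?case
    unfolding sum.lessThan_Suc[of _ "Suc N"] Suc.IH
    using m_pos[of "Suc N"] by (simp add: schr_Suc field_simps)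
qed

lemma green_formula:
  assumes "\<phi> \<in> Cc"
  shows "l2_inner m (schr V \<phi>) f = l2_inner m \<phi> (schr V f)"
proof -
  obtain N where N: "\<And>x. N \<le> x \<Longrightarrow> \<phi> x = 0" using assms by (auto simp: Cc_iff)
  have "l2_inner m (schr V \<phi>) f - l2_inner m \<phi> (schr V f)
      = (\<Sum>x<Suc N. schr V \<phi> x * f x * m x - \<phi> x * schr V f x * m x)"
    using N schr_vanishes[OF N]
    by (simp add: l2_inner_finite_support[of "Suc N"] sum_subtractf del: sum.lessThan_Suc)
  also have "\<dots> = 0"
    unfolding green_formula_partial using N by simp
  finally show ?thesis by simp
qed

text \<open>The equation at \<open>x\<close> can be solved for \<open>d (x + 1)\<close> as \<open>b x (x + 1) > 0\<close>, so a solution is determined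
  by its value at \<open>0\<close>.\<close>

lemma solution_zero:
  assumes sol: "\<And>x. schr V d x = 0" and "d 0 = 0"
  shows "d x = 0"
proof -
  have step: "d (Suc (Suc x)) = 0" if "d x = 0" "d (Suc x) = 0" for x
    using sol[of "Suc x"] that b_pos[of "Suc x"] m_pos[of "Suc x"] by (simp add: schr_Suc)
  have "d (Suc 0) = 0"
    using sol[of 0] \<open>d 0 = 0\<close> b_pos[of 0] m_pos[of 0] by (simp add: schr_0)
  then have "d x = 0 \<and> d (Suc x) = 0"
    using \<open>d 0 = 0\<close> step by (induction x) auto
  then show ?thesis ..
qed

lemma solution_unique:
  assumes u: "\<And>x. schr V u x = 0" "u 0 = 1" and w: "\<And>x. schr V w x = 0"
  shows "w x = w 0 * u x"
proof -
  have "schr V (\<lambda>x. 1 * w x + (- w 0) * u x) y = 0" for y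
    unfolding schr_lincomb using u w by simp
  from solution_zero[OF this, of x] show ?thesis using u(2) by simp
qed

text \<open>The equation \<open>(\<Delta> + V) \<phi> = \<psi>\<close> is solved from the right end: its value at \<open>n\<close> forces \<open>\<phi> (n - 1)\<close>,
  and subtracting this one-point contribution leaves a problem with smaller support. Green's
  formula keeps the right-hand side orthogonal to \<open>u\<close> throughout, so that in the end
  \<open>\<psi> 0 * u 0 * m 0 = 0\<close>, which is the one compatibility condition.\<close>

lemma orthogonal_in_range:
  assumes u: "\<And>x. schr V u x = 0" "u 0 = 1"
    and "\<And>x. n < x \<Longrightarrow> \<psi> x = 0" and "(\<Sum>x<Suc n. \<psi> x * u x * m x) = 0"
  shows "\<exists>\<phi>. (\<forall>x\<ge>n. \<phi> x = 0) \<and> schr V \<phi> = \<psi>"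
  using assms(3,4)
proof (induction n arbitrary: \<psi>)
  case 0
  then have "\<psi> x = 0" for x using m_pos[of 0] u by (cases x) auto
  moreover have "schr V (\<lambda>x. 0) x = 0" for x by (cases x) (simp_all add: schr_0 schr_Suc)
  ultimately show ?case by (intro exI[of _ "\<lambda>x. 0"]) auto
next
  case (Suc n)
  define c where "c = - \<psi> (Suc n) * m (Suc n) / b n (Suc n)"
  define e where "e = (\<lambda>x. if x = n then c else 0)"
  define \<psi>' where "\<psi>' = (\<lambda>x. \<psi> x - schr V e x)"
  have "schr V e (Suc n) = \<psi> (Suc n)"
    using b_pos[of n] m_pos[of "Suc n"] by (simp add: schr_Suc e_def c_def)
  moreover have "schr V e x = 0" if "Suc n < x" for x
    using that by (intro schr_vanishes[of "Suc n"]) (auto simp: e_def)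
  ultimately have zero: "\<psi>' x = 0" if "n < x" for x
    using that Suc.prems(1)[of x] by (cases "x = Suc n") (auto simp: \<psi>'_def)
  have "(\<Sum>x<Suc (Suc n). schr V e x * u x * m x) = 0"
    using green_formula_partial[where N = "Suc n" and f = e and g = u and V = V] u(1)
    by (simp add: e_def)
  then have "(\<Sum>x<Suc (Suc n). \<psi>' x * u x * m x) = 0"
    using Suc.prems(2) by (simp add: \<psi>'_def left_diff_distrib sum_subtractf)
  then have "(\<Sum>x<Suc n. \<psi>' x * u x * m x) = 0" using zero[of "Suc n"] by simp
  from Suc.IH[OF zero this] obtain \<phi> where \<phi>: "\<forall>x\<ge>n. \<phi> x = 0" "schr V \<phi> = \<psi>'"
    by blast
  have "schr V (\<lambda>x. 1 * \<phi> x + 1 * e x) = \<psi>"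
    unfolding schr_lincomb using \<phi> by (auto simp: fun_eq_iff \<psi>'_def)
  then show ?case using \<phi>(1)
    by (intro exI[of _ "\<lambda>x. 1 * \<phi> x + 1 * e x"]) (auto simp: e_def)
qed

text \<open>Truncate \<open>g\<close> to \<open>h\<close> and make \<open>h\<close> orthogonal to \<open>u\<close> by subtracting a multiple of \<open>u\<close> restricted
  to \<open>{0..n}\<close>. With \<open>p = \<langle>h, u\<rangle>\<close> and \<open>S\<close> the squared norm of the restricted \<open>u\<close>, the correction has norm
  \<open>\<bar>p\<bar> / sqrt S\<close>, where \<open>p\<close> does not depend on \<open>n\<close> and \<open>S\<close> is unbounded because \<open>u \<notin> l\<^sup>2\<close>.\<close>

lemma dense_range:
  assumes u: "\<And>x. schr V u x = 0" "u 0 = 1" and "u \<notin> l2 m"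
    and g: "g \<in> l2 m" and "0 < \<epsilon>"
  shows "\<exists>\<phi>\<in>Cc. l2_norm m (\<lambda>x. schr V \<phi> x - g x) < \<epsilon>"
proof -
  obtain N where N: "l2_norm m (\<lambda>x. g x - (if x < N then g x else 0)) < \<epsilon> / 2"
    using l2_truncation[OF g, of "\<epsilon> / 2"] \<open>0 < \<epsilon>\<close> by auto
  define h where "h = (\<lambda>x. if x < N then g x else 0)"
  have g_h: "l2_norm m (\<lambda>x. g x - h x) < \<epsilon> / 2" using N by (simp add: h_def)
  define p where "p = (\<Sum>x<N. h x * u x * m x)"
  define S where "S n = (\<Sum>x<n. (u x)\<^sup>2 * m x)" for n
  \<comment> \<open>This threshold for \<open>S\<close> makes the correction smaller than \<open>\<epsilon> / 2\<close>.\<close>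
  have "\<not> (\<forall>n. S n \<le> (2 * p / \<epsilon>)\<^sup>2)"
    using \<open>u \<notin> l2 m\<close> summableI_nonneg_bounded[of "\<lambda>x. (u x)\<^sup>2 * m x"]
    unfolding l2_def S_def by fastforce
  then obtain n0 where n0: "(2 * p / \<epsilon>)\<^sup>2 < S n0" by (auto simp: not_le)
  define n where "n = max n0 N"
  have "S n0 \<le> S (Suc n)"
    unfolding S_def n_def by (intro sum_mono2) auto
  then have n: "(2 * p / \<epsilon>)\<^sup>2 < S (Suc n)" using n0 by simp
  then have S_pos: "0 < S (Suc n)" by (rule le_less_trans[rotated]) simp
  define t where "t = (\<lambda>x. if x < Suc n then u x else 0)"
  have t: "t \<in> Cc" unfolding Cc_iff by (rule exI[of _ "Suc n"]) (simp add: t_def)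
  have h: "h \<in> Cc" unfolding Cc_iff by (rule exI[of _ N]) (simp add: h_def)
  define \<psi> where "\<psi> = (\<lambda>x. h x - p / S (Suc n) * t x)"
  have "(\<Sum>x<Suc n. h x * u x * m x) = p"
    unfolding p_def by (rule sum.mono_neutral_right) (auto simp: h_def n_def)
  moreover have "(\<Sum>x<Suc n. t x * u x * m x) = S (Suc n)"
    unfolding S_def by (rule sum.cong) (auto simp: t_def power2_eq_square)
  moreover have "(\<Sum>x<Suc n. \<psi> x * u x * m x)
      = (\<Sum>x<Suc n. h x * u x * m x) - p / S (Suc n) * (\<Sum>x<Suc n. t x * u x * m x)"
    unfolding sum_distrib_left sum_subtractf[symmetric]
    by (rule sum.cong) (auto simp: \<psi>_def algebra_simps)
  ultimately have "(\<Sum>x<Suc n. \<psi> x * u x * m x) = 0" using S_pos by simp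
  moreover have "\<psi> x = 0" if "n < x" for x
  proof -
    have "\<not> x < Suc n" "\<not> x < N" using that by (auto simp: n_def)
    then show ?thesis by (simp add: \<psi>_def h_def t_def)
  qed
  ultimately obtain \<phi> where \<phi>: "\<forall>x\<ge>n. \<phi> x = 0" "schr V \<phi> = \<psi>"
    using orthogonal_in_range[OF u, of n \<psi>] by blast
  have mem: "h \<in> l2 m" "t \<in> l2 m" "\<psi> \<in> l2 m"
    unfolding \<psi>_def by (intro l2_diff l2_scale Cc_subset_l2 h t)+
  have "l2_inner m t t = (\<Sum>x<Suc n. t x * t x * m x)"
    by (rule l2_inner_finite_support) (simp add: t_def)
  also have "\<dots> = S (Suc n)"
    unfolding S_def by (rule sum.cong) (auto simp: t_def power2_eq_square)
  finally have "l2_norm m t = sqrt (S (Suc n))" by (simp add: l2_norm_def)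
  moreover have "l2_norm m (\<lambda>x. h x - \<psi> x) = \<bar>p / S (Suc n)\<bar> * l2_norm m t"
    unfolding \<psi>_def using l2_norm_scale[OF mem(2), of "p / S (Suc n)"] by simp
  ultimately have "l2_norm m (\<lambda>x. h x - \<psi> x) = \<bar>p\<bar> / sqrt (S (Suc n))"
    using S_pos real_divide_square_eq[of "sqrt (S (Suc n))" "\<bar>p\<bar>"] by (simp add: mult.commute)
  moreover have "\<bar>p\<bar> / sqrt (S (Suc n)) < \<epsilon> / 2"
  proof -
    have "\<bar>2 * p / \<epsilon>\<bar> < sqrt (S (Suc n))"
      by (rule real_less_rsqrt) (simp only: power2_abs n)
    then have "2 * \<bar>p\<bar> < sqrt (S (Suc n)) * \<epsilon>"
      using \<open>0 < \<epsilon>\<close> by (simp add: abs_mult pos_divide_less_eq)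
    then show ?thesis using S_pos by (simp add: pos_divide_less_eq mult.commute)
  qed
  ultimately have "l2_norm m (\<lambda>x. h x - \<psi> x) < \<epsilon> / 2" by simp
  moreover have "l2_norm m (\<lambda>x. g x - \<psi> x)
      \<le> l2_norm m (\<lambda>x. g x - h x) + l2_norm m (\<lambda>x. h x - \<psi> x)"
    by (rule l2_norm_triangle_diff[OF g mem(1,3)])
  ultimately have "l2_norm m (\<lambda>x. schr V \<phi> x - g x) < \<epsilon>"
    using g_h unfolding \<phi>(2) l2_norm_minus_commute[of \<psi>] by linarith
  moreover have "\<phi> \<in> Cc" using \<phi>(1) by (auto simp: Cc_iff)
  ultimately show ?thesis by blast
qed

section \<open>Essential self-adjointness\<close>

lemma schroedinger_eq: "schroedinger b m W = {(\<phi>, schr W \<phi>) | \<phi>. \<phi> \<in> Cc}"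
  by (simp add: schroedinger_def schr_def[abs_def])

lemma schroedinger_subset_l2: "schroedinger b m W \<subseteq> l2 m \<times> l2 m"
  unfolding schroedinger_eq using schr_Cc Cc_subset_l2 by blast

lemma linear_operator_schroedinger: "linear_operator m (schroedinger b m W)"
proof -
  have lincomb: "((\<lambda>x. a * \<phi> x + c * \<psi> x), (\<lambda>x. a * schr W \<phi> x + c * schr W \<psi> x))
      \<in> schroedinger b m W" if "\<phi> \<in> Cc" "\<psi> \<in> Cc" for a c \<phi> \<psi>
    unfolding schroedinger_eq using Cc_lincomb[OF that, of a c]
    by (auto simp: schr_lincomb intro!: exI[of _ "\<lambda>x. a * \<phi> x + c * \<psi> x"])
  have zero: "(\<lambda>x. 0) \<in> Cc" by (simp add: Cc_def)
  show ?thesis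
    unfolding linear_operator_def
  proof (intro conjI)
    show "single_valued (schroedinger b m W)"
      unfolding schroedinger_eq by (auto simp: single_valued_def)
    show "((\<lambda>x. 0), (\<lambda>x. 0)) \<in> schroedinger b m W"
      using lincomb[OF zero zero, of 0 0] by simp
    show "\<forall>(f, g)\<in>schroedinger b m W. \<forall>(f', g')\<in>schroedinger b m W.
        ((\<lambda>x. f x + f' x), (\<lambda>x. g x + g' x)) \<in> schroedinger b m W"
      using lincomb[of _ _ 1 1] by (auto simp: schroedinger_eq)
    show "\<forall>a. \<forall>(f, g)\<in>schroedinger b m W.
        ((\<lambda>x. a * f x), (\<lambda>x. a * g x)) \<in> schroedinger b m W"
      using lincomb[OF _ zero, of _ _ 0] by (auto simp: schroedinger_eq)
  qed (rule schroedinger_subset_l2)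
qed

lemma densely_defined_schroedinger: "densely_defined m (schroedinger b m W)"
proof -
  have "Domain (schroedinger b m W) = Cc" by (auto simp: schroedinger_eq)
  then show ?thesis
    unfolding densely_defined_def using Cc_dense Cc_subset_l2 by auto
qed

lemma symmetric_schroedinger: "symmetric m (schroedinger b m W)"
  unfolding symmetric_def schroedinger_eq using green_formula by auto

text \<open>Testing against the indicator functions of points shows that the adjoint acts as the formal
  operator; conversely, Green's formula holds as soon as one of the two functions has finite
  support.\<close>

lemma adjoint_schroedinger:
  "(f, v) \<in> l2_adjoint m (schroedinger b m W) \<longleftrightarrow> f \<in> l2 m \<and> v \<in> l2 m \<and> v = schr W f"
proof
  assume adj: "(f, v) \<in> l2_adjoint m (schroedinger b m W)"
  have "v x = schr W f x" for x
  proof -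
    define e :: "nat \<Rightarrow> real" where "e = (\<lambda>y. if y = x then 1 else 0)"
    have point: "l2_inner m e g = g x * m x" for g
      using l2_inner_finite_support[of "Suc x" e g] by (simp add: e_def)
    have "e \<in> Cc" by (simp add: Cc_def e_def)
    then have "l2_inner m (schr W e) f = l2_inner m e v"
      using adj by (auto simp: l2_adjoint_def schroedinger_eq)
    then have "l2_inner m e v = l2_inner m e (schr W f)"
      using green_formula[OF \<open>e \<in> Cc\<close>, of W f] by simp
    then have "v x * m x = schr W f x * m x" unfolding point .
    then show ?thesis using m_pos[of x] by (metis less_irrefl mult_right_cancel)
  qed
  then show "f \<in> l2 m \<and> v \<in> l2 m \<and> v = schr W f"
    using adj by (auto simp: l2_adjoint_def)
next
  assume "f \<in> l2 m \<and> v \<in> l2 m \<and> v = schr W f"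
  then show "(f, v) \<in> l2_adjoint m (schroedinger b m W)"
    using green_formula by (auto simp: l2_adjoint_def schroedinger_eq)
qed

text \<open>The quadratic form of \<open>\<Delta> + W - \<lambda>\<close> is at least \<open>(K - \<lambda>) \<parallel>\<phi>\<parallel>\<^sup>2\<close>; the Cauchy-Schwarz inequality turns
  this into a bound on the norm.\<close>

lemma coercive:
  assumes sb: "semibounded m (schroedinger b m W) K" and \<phi>: "\<phi> \<in> Cc"
  shows "(K - lam) * l2_norm m \<phi> \<le> l2_norm m (schr (\<lambda>x. W x - lam) \<phi>)"
proof -
  let ?V = "\<lambda>x. W x - lam" and ?n = "l2_norm m \<phi>"
  have mem: "\<phi> \<in> l2 m" "schr W \<phi> \<in> l2 m" "schr ?V \<phi> \<in> l2 m"
    using \<phi> schr_Cc Cc_subset_l2 by auto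
  have "K * l2_inner m \<phi> \<phi> \<le> l2_inner m (schr W \<phi>) \<phi>"
    using sb \<phi> by (auto simp: semibounded_def schroedinger_eq)
  moreover have "l2_inner m (schr ?V \<phi>) \<phi> = l2_inner m (schr W \<phi>) \<phi> - lam * l2_inner m \<phi> \<phi>"
    using l2_inner_lincomb[OF mem(2,1,1), of 1 "- lam"]
    unfolding schr_potential_diff[abs_def] by simp
  ultimately have "(K - lam) * ?n\<^sup>2 \<le> l2_inner m (schr ?V \<phi>) \<phi>"
    by (simp add: l2_norm_square mem left_diff_distrib)
  also have "\<dots> \<le> l2_norm m (schr ?V \<phi>) * ?n"
    using l2_cauchy_schwarz[OF mem(3,1)] by simp
  finally have "((K - lam) * ?n) * ?n \<le> l2_norm m (schr ?V \<phi>) * ?n"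
    by (simp add: power2_eq_square mult.assoc)
  then show ?thesis
    using l2_norm_nonneg[OF mem(1)] l2_norm_nonneg[OF mem(3)]
    by (cases "?n = 0") (auto dest: mult_right_le_imp_le)
qed

text \<open>The density of the range together with coercivity produces, for \<open>f\<close> in the domain of the
  adjoint, an \<open>h\<close> in the domain of the closure with \<open>(\<Delta> + W - \<lambda>) (f - h) = 0\<close>. Solutions being
  multiples of \<open>u \<notin> l\<^sup>2\<close>, this forces \<open>h = f\<close>.\<close>

lemma closure_eq_adjoint:
  assumes sb: "semibounded m (schroedinger b m W) K" and "lam < K"
    and u: "\<And>x. schr (\<lambda>x. W x - lam) u x = 0" "u 0 = 1" and "u \<notin> l2 m"
  shows "l2_closure m (schroedinger b m W) = l2_adjoint m (schroedinger b m W)"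
proof
  let ?V = "\<lambda>x. W x - lam"
  show "l2_closure m (schroedinger b m W) \<subseteq> l2_adjoint m (schroedinger b m W)"
    by (intro closure_subset_adjoint schroedinger_subset_l2 symmetric_schroedinger)
  show "l2_adjoint m (schroedinger b m W) \<subseteq> l2_closure m (schroedinger b m W)"
  proof clarify
    fix f v assume "(f, v) \<in> l2_adjoint m (schroedinger b m W)"
    then have f: "f \<in> l2 m" and v: "v \<in> l2 m" and v_eq: "v = schr W f"
      by (auto simp: adjoint_schroedinger)
    define g where "g = schr ?V f"
    have "g = (\<lambda>x. v x - lam * f x)"
      by (simp add: g_def v_eq schr_potential_diff fun_eq_iff)
    then have g: "g \<in> l2 m" using f v by (auto intro: l2_diff l2_scale)
    have "\<exists>\<phi>\<in>Cc. l2_norm m (\<lambda>x. schr ?V \<phi> x - g x) < inverse (real (Suc n))" for n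
      by (rule dense_range[OF u \<open>u \<notin> l2 m\<close> g]) simp
    then obtain \<Phi> where \<Phi>: "\<And>n. \<Phi> n \<in> Cc"
      and small: "\<And>n. l2_norm m (\<lambda>x. schr ?V (\<Phi> n) x - g x) < inverse (real (Suc n))"
      by metis
    have mem: "\<Phi> n \<in> l2 m" "schr U (\<Phi> n) \<in> l2 m" for n U
      using \<Phi> schr_Cc Cc_subset_l2 by auto
    have range_lim: "(\<lambda>n. l2_norm m (\<lambda>x. schr ?V (\<Phi> n) x - g x)) \<longlonglongrightarrow> 0"
    proof (rule tendsto_sandwich[OF _ _ tendsto_const LIMSEQ_inverse_real_of_nat])
      show "\<forall>\<^sub>F n in sequentially. 0 \<le> l2_norm m (\<lambda>x. schr ?V (\<Phi> n) x - g x)"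
        by (intro always_eventually allI l2_norm_nonneg l2_diff mem g)
      show "\<forall>\<^sub>F n in sequentially. l2_norm m (\<lambda>x. schr ?V (\<Phi> n) x - g x) \<le> inverse (real (Suc n))"
        by (intro always_eventually allI less_imp_le small)
    qed
    have cauchy: "\<exists>N. \<forall>p\<ge>N. \<forall>q\<ge>N. l2_norm m (\<lambda>x. \<Phi> p x - \<Phi> q x) < \<epsilon>" if "0 < \<epsilon>" for \<epsilon>
    proof -
      have "0 < (K - lam) * \<epsilon> / 2" using that \<open>lam < K\<close> by simp
      then obtain N where
        N: "\<And>n. N \<le> n \<Longrightarrow> norm (l2_norm m (\<lambda>x. schr ?V (\<Phi> n) x - g x) - 0) < (K - lam) * \<epsilon> / 2"
        using LIMSEQ_D[OF range_lim] by blast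
      have "l2_norm m (\<lambda>x. \<Phi> p x - \<Phi> q x) < \<epsilon>" if "N \<le> p" "N \<le> q" for p q
      proof -
        have "(\<lambda>x. \<Phi> p x - \<Phi> q x) \<in> Cc" using Cc_lincomb[OF \<Phi> \<Phi>, of 1 p "-1" q] by simp
        from coercive[OF sb this, of lam]
        have "(K - lam) * l2_norm m (\<lambda>x. \<Phi> p x - \<Phi> q x)
            \<le> l2_norm m (\<lambda>x. schr ?V (\<Phi> p) x - schr ?V (\<Phi> q) x)"
          by (simp add: schr_diff[abs_def])
        also have "\<dots> \<le> l2_norm m (\<lambda>x. schr ?V (\<Phi> p) x - g x)
            + l2_norm m (\<lambda>x. schr ?V (\<Phi> q) x - g x)"
          using l2_norm_triangle_diff[OF mem(2) g mem(2)] l2_norm_minus_commute[of g] by simp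
        also have "\<dots> < (K - lam) * \<epsilon>"
          using N[OF that(1)] N[OF that(2)] by simp
        finally show ?thesis using \<open>lam < K\<close> by (simp add: mult_less_cancel_left)
      qed
      then show ?thesis by blast
    qed
    obtain h where h: "h \<in> l2 m" and pointwise: "\<And>x. (\<lambda>n. \<Phi> n x) \<longlonglongrightarrow> h x"
      and norm_lim: "(\<lambda>n. l2_norm m (\<lambda>x. \<Phi> n x - h x)) \<longlonglongrightarrow> 0"
      using l2_complete[OF mem(1) cauchy] by blast
    have "schr ?V h x = g x" for x
    proof (rule LIMSEQ_unique)
      show "(\<lambda>n. schr ?V (\<Phi> n) x) \<longlonglongrightarrow> schr ?V h x"
        by (rule schr_tendsto[OF pointwise])
      have "norm (schr ?V (\<Phi> n) x - g x)
          \<le> norm (l2_norm m (\<lambda>x. schr ?V (\<Phi> n) x - g x)) * inverse (sqrt (m x))" for n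
        using abs_le_l2_norm[OF l2_diff[OF mem(2) g], of ?V n x] m_pos[of x]
        by (simp add: pos_le_divide_eq flip: divide_inverse)
      then have "(\<lambda>n. schr ?V (\<Phi> n) x - g x) \<longlonglongrightarrow> 0"
        by (intro tendsto_0_le[OF range_lim] always_eventually allI)
      then show "(\<lambda>n. schr ?V (\<Phi> n) x) \<longlonglongrightarrow> g x" by (rule LIM_zero_cancel)
    qed
    then have "schr ?V (\<lambda>x. f x - h x) x = 0" for x
      by (simp add: schr_diff g_def)
    define c where "c = f 0 - h 0"
    have multiple: "f x - h x = c * u x" for x
      unfolding c_def by (rule solution_unique[OF u \<open>\<And>x. schr ?V (\<lambda>x. f x - h x) x = 0\<close>])
    have "c = 0"
    proof (rule ccontr)
      assume "c \<noteq> 0"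
      then have "u x = inverse c * (f x - h x)" for x
        unfolding multiple by (simp add: mult.assoc[symmetric] del: mult.assoc)
      then have "u = (\<lambda>x. inverse c * (f x - h x))" by blast
      then show False using l2_scale[OF l2_diff[OF f h]] \<open>u \<notin> l2 m\<close> by metis
    qed
    then have "h = f" using multiple by (simp add: fun_eq_iff)
    have "(\<lambda>n. l2_norm m (\<lambda>x. schr W (\<Phi> n) x - v x)) \<longlonglongrightarrow> 0"
    proof (rule tendsto_sandwich[OF _ _ tendsto_const])
      have "l2_norm m (\<lambda>x. schr W (\<Phi> n) x - v x)
          \<le> l2_norm m (\<lambda>x. schr ?V (\<Phi> n) x - g x) + \<bar>lam\<bar> * l2_norm m (\<lambda>x. \<Phi> n x - f x)" for n
      proof -
        have "(\<lambda>x. schr W (\<Phi> n) x - v x)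
            = (\<lambda>x. (schr ?V (\<Phi> n) x - g x) + lam * (\<Phi> n x - f x))"
          by (simp add: fun_eq_iff g_def v_eq schr_potential_diff algebra_simps)
        then show ?thesis
          using l2_norm_triangle[OF l2_diff[OF mem(2) g] l2_scale[OF l2_diff[OF mem(1) f]],
              of ?V n lam n] l2_norm_scale[OF l2_diff[OF mem(1) f], of lam n]
          by simp
      qed
      then show "\<forall>\<^sub>F n in sequentially. l2_norm m (\<lambda>x. schr W (\<Phi> n) x - v x)
          \<le> l2_norm m (\<lambda>x. schr ?V (\<Phi> n) x - g x) + \<bar>lam\<bar> * l2_norm m (\<lambda>x. \<Phi> n x - f x)"
        by simp
      show "(\<lambda>n. l2_norm m (\<lambda>x. schr ?V (\<Phi> n) x - g x) + \<bar>lam\<bar> * l2_norm m (\<lambda>x. \<Phi> n x - f x))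
          \<longlonglongrightarrow> 0"
        using tendsto_add[OF range_lim tendsto_mult_left[OF norm_lim, of "\<bar>lam\<bar>"]] \<open>h = f\<close> by simp
      show "\<forall>\<^sub>F n in sequentially. 0 \<le> l2_norm m (\<lambda>x. schr W (\<Phi> n) x - v x)"
        by (intro always_eventually allI l2_norm_nonneg l2_diff mem v)
    qed
    moreover have "(\<Phi> n, schr W (\<Phi> n)) \<in> schroedinger b m W" for n
      using \<Phi> by (auto simp: schroedinger_eq)
    ultimately show "(f, v) \<in> l2_closure m (schroedinger b m W)"
      using f v norm_lim unfolding l2_closure_def \<open>h = f\<close> mem_Collect_eq case_prod_conv
      by (intro conjI exI[of _ \<Phi>] exI[of _ "\<lambda>n. schr W (\<Phi> n)"]) auto
  qed
qed

text \<open>If \<open>F n \<longlonglongrightarrow> u\<close> and \<open>A (F n) \<longlonglongrightarrow> \<lambda> u\<close>, then \<open>(A - \<lambda>) (F n) \<longlonglongrightarrow> 0\<close>, so coercivity gives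
  \<open>F n \<longlonglongrightarrow> 0\<close> and \<open>u = 0\<close>.\<close>

lemma closure_no_eigenvector:
  assumes sb: "semibounded m (schroedinger b m W) K" and "lam < K"
    and u: "(u, \<lambda>x. lam * u x) \<in> l2_closure m (schroedinger b m W)"
  shows "u x = 0"
proof -
  let ?V = "\<lambda>x. W x - lam"
  obtain F G where FG: "\<And>n::nat. (F n, G n) \<in> schroedinger b m W"
    and F: "(\<lambda>n. l2_norm m (\<lambda>x. F n x - u x)) \<longlonglongrightarrow> 0"
    and G: "(\<lambda>n. l2_norm m (\<lambda>x. G n x - lam * u x)) \<longlonglongrightarrow> 0"
    and u_mem: "u \<in> l2 m"
    using u by (rule l2_closureE) (rule that)
  have Fn: "F n \<in> Cc" and Gn: "G n = schr W (F n)" for n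
    using FG[of n] by (auto simp: schroedinger_eq)
  have mem: "F n \<in> l2 m" "G n \<in> l2 m" for n
    using FG schroedinger_subset_l2 by blast+
  define d where "d n = l2_norm m (\<lambda>x. F n x - u x)" for n
  define e where "e n = l2_norm m (\<lambda>x. G n x - lam * u x)" for n
  have bound: "(K - lam) * l2_norm m u \<le> (K - lam) * d n + (e n + \<bar>lam\<bar> * d n)" for n
  proof -
    have "(K - lam) * l2_norm m (F n) \<le> l2_norm m (schr ?V (F n))"
      by (rule coercive[OF sb Fn])
    also have "schr ?V (F n) = (\<lambda>x. (G n x - lam * u x) + (- lam) * (F n x - u x))"
      by (simp add: fun_eq_iff Gn schr_potential_diff algebra_simps)
    also have "l2_norm m \<dots> \<le> e n + \<bar>lam\<bar> * d n"
      using l2_norm_triangle[OF l2_diff[OF mem(2) l2_scale[OF u_mem]]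
          l2_scale[OF l2_diff[OF mem(1) u_mem]], of n lam "- lam" n]
        l2_norm_scale[OF l2_diff[OF mem(1) u_mem], of "- lam" n]
      by (simp add: e_def d_def)
    finally have 1: "(K - lam) * l2_norm m (F n) \<le> e n + \<bar>lam\<bar> * d n" .
    have "l2_norm m u \<le> d n + l2_norm m (F n)"
      using l2_norm_triangle[OF l2_diff[OF u_mem mem(1)] mem(1), of n n]
        l2_norm_minus_commute[of u "F n"] by (simp add: d_def)
    then have "(K - lam) * l2_norm m u \<le> (K - lam) * (d n + l2_norm m (F n))"
      using \<open>lam < K\<close> by (intro mult_left_mono) auto
    with 1 show ?thesis by (simp add: distrib_left)
  qed
  have "d \<longlonglongrightarrow> 0" "e \<longlonglongrightarrow> 0" using F G by (simp_all add: d_def[abs_def] e_def[abs_def])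
  then have "(\<lambda>n. (K - lam) * d n + (e n + \<bar>lam\<bar> * d n))
      \<longlonglongrightarrow> (K - lam) * 0 + (0 + \<bar>lam\<bar> * 0)"
    by (intro tendsto_intros)
  then have "(K - lam) * l2_norm m u \<le> (K - lam) * 0 + (0 + \<bar>lam\<bar> * 0)"
    by (rule LIMSEQ_le_const) (use bound in blast)
  then have "l2_norm m u \<le> 0" using \<open>lam < K\<close> by (simp add: mult_le_0_iff)
  then have "\<bar>u x\<bar> * sqrt (m x) \<le> 0" using abs_le_l2_norm[OF u_mem, of x] by linarith
  then show ?thesis using m_pos[of x] by (simp add: mult_le_0_iff)
qed

text \<open>A criterion of limit-point type: since the adjoint of the closure is the
  adjoint of \<open>A\<close>, the closure is self-adjoint precisely if it equals that adjoint.\<close>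

theorem essentially_self_adjoint_iff:
  assumes sb: "semibounded m (schroedinger b m W) K" and "lam < K"
    and u: "\<And>x. schr (\<lambda>x. W x - lam) u x = 0" "u 0 = 1"
  shows "essentially_self_adjoint m (schroedinger b m W) \<longleftrightarrow> u \<notin> l2 m"
proof
  let ?A = "schroedinger b m W"
  assume "essentially_self_adjoint m ?A"
  then have closure: "l2_closure m ?A = l2_adjoint m ?A"
    unfolding essentially_self_adjoint_def self_adjoint_def
    using l2_adjoint_closure[OF schroedinger_subset_l2, of W] by metis
  show "u \<notin> l2 m"
  proof
    assume "u \<in> l2 m"
    moreover have "(\<lambda>x. lam * u x) = schr W u"
      using u(1) by (simp add: schr_potential_diff fun_eq_iff)
    ultimately have "(u, \<lambda>x. lam * u x) \<in> l2_closure m ?A"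
      unfolding closure adjoint_schroedinger using l2_scale[of u lam] by simp
    from closure_no_eigenvector[OF sb \<open>lam < K\<close> this, of 0] show False using u(2) by simp
  qed
next
  let ?A = "schroedinger b m W"
  assume "u \<notin> l2 m"
  have closure: "l2_closure m ?A = l2_adjoint m ?A"
    by (rule closure_eq_adjoint[OF sb \<open>lam < K\<close> u \<open>u \<notin> l2 m\<close>])
  have "Domain ?A \<subseteq> Domain (l2_closure m ?A)"
    using subset_l2_closure[OF schroedinger_subset_l2] by blast
  moreover have "Domain (l2_closure m ?A) \<subseteq> l2 m" by (auto simp: l2_closure_def)
  ultimately have "densely_defined m (l2_closure m ?A)"
    using densely_defined_schroedinger[of W] unfolding densely_defined_def by (meson subsetD)
  moreover have "l2_adjoint m (l2_closure m ?A) = l2_closure m ?A"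
    using l2_adjoint_closure[OF schroedinger_subset_l2, of W] closure by metis
  ultimately show "essentially_self_adjoint m ?A"
    unfolding essentially_self_adjoint_def self_adjoint_def
    using linear_operator_schroedinger densely_defined_schroedinger symmetric_schroedinger by blast
qed

end

section \<open>Sums over compositions into ones and twos\<close>

text \<open>The factor of a part \<open>l\<close>, unifying the two products of the tuple weight. Only the parts \<open>1\<close> and
  \<open>2\<close> occur in the sums; the neutral value \<open>1\<close> for other parts makes the equality with the tuple weight hold
  for all lists.\<close>

definition path_factor ::
    "(nat \<Rightarrow> nat \<Rightarrow> real) \<Rightarrow> (nat \<Rightarrow> real) \<Rightarrow> (nat \<Rightarrow> real) \<Rightarrow> real \<Rightarrow> int \<Rightarrow> int \<Rightarrow> real" where
  "path_factor b m W lam l c =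
     (if l = 1 then factor1 b m W lam c else if l = 2 then factor2 b c else 1)"

text \<open>The tuple weight by recursion on the first part: after a step \<open>l\<close> the remaining walk starts at
  \<open>k - l\<close>. The starting point is an integer since a walk counted by \<open>\<beta>\<^sub>k\<close> ends at \<open>-1\<close>.\<close>

primrec path_weight ::
    "(nat \<Rightarrow> nat \<Rightarrow> real) \<Rightarrow> (nat \<Rightarrow> real) \<Rightarrow> (nat \<Rightarrow> real) \<Rightarrow> real \<Rightarrow> int \<Rightarrow> int list \<Rightarrow> real" where
  "path_weight b m W lam k [] = 1"
| "path_weight b m W lam k (l # ls) =
     path_factor b m W lam l (k - l) * path_weight b m W lam (k - l) ls"

lemma path_weight_eq_prod:
  "path_weight b m W lam k ls
     = (\<Prod>i<length ls. path_factor b m W lam (ls ! i) (k - (\<Sum>n<Suc i. ls ! n)))"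
proof (induction ls arbitrary: k)
  case (Cons l ls)
  have "(\<Sum>n<Suc (Suc i). (l # ls) ! n) = l + (\<Sum>n<Suc i. ls ! n)" for i
    by (subst sum.lessThan_Suc_shift) simp
  then show ?case
    by (simp add: Cons.IH prod.lessThan_Suc_shift algebra_simps del: sum.lessThan_Suc prod.lessThan_Suc)
qed simp

lemma tuple_weight_eq: "tuple_weight b m W lam k ls = path_weight b m W lam (int k) ls"
proof -
  have "tuple_weight b m W lam k ls
      = (\<Prod>i\<in>{1..length ls}. path_factor b m W lam (ls ! (i - 1)) (c_idx k ls i))"
    unfolding tuple_weight_def prod.inter_filter[OF finite_atLeastAtMost] prod.distrib[symmetric]
    by (rule prod.cong) (auto simp: path_factor_def)
  also have "\<dots> = (\<Prod>i<length ls. path_factor b m W lam (ls ! i) (c_idx k ls (Suc i)))"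
    using prod.atLeast1_atMost_eq[of "\<lambda>i. path_factor b m W lam (ls ! (i - 1)) (c_idx k ls i)"] by simp
  also have "\<dots> = path_weight b m W lam (int k) ls"
    unfolding path_weight_eq_prod c_idx_def
    using sum.atLeast1_atMost_eq[of "\<lambda>n. ls ! (n - 1)"] by simp
  finally show ?thesis .
qed

text \<open>Tuples of all lengths at once, as the recursion on the first part changes the length.\<close>

definition paths :: "nat \<Rightarrow> int list set" where
  "paths s = {ls. set ls \<subseteq> {1, 2} \<and> sum_list ls = int s}"

lemma length_le_sum_list: "set ls \<subseteq> {1, 2::int} \<Longrightarrow> int (length ls) \<le> sum_list ls"
  by (induction ls) auto

lemma length_paths_le: "ls \<in> paths s \<Longrightarrow> length ls \<le> s"
  using length_le_sum_list[of ls] unfolding paths_def by simp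

lemma finite_paths: "finite (paths s)"
proof (rule finite_subset)
  show "paths s \<subseteq> {ls. set ls \<subseteq> {1, 2} \<and> length ls \<le> s}"
    using length_paths_le by (auto simp: paths_def)
qed (rule finite_lists_length_le, simp)

lemma Nil_in_paths_iff: "[] \<in> paths s \<longleftrightarrow> s = 0"
  by (auto simp: paths_def)

lemma Cons_in_paths_iff:
  "l # ls \<in> paths s \<longleftrightarrow> l = 1 \<and> 1 \<le> s \<and> ls \<in> paths (s - 1) \<or> l = 2 \<and> 2 \<le> s \<and> ls \<in> paths (s - 2)"
  using length_le_sum_list[of ls] by (auto simp: paths_def of_nat_diff)

lemma paths_0: "paths 0 = {[]}"
  using length_paths_le[of _ 0] by (auto simp: Nil_in_paths_iff)

lemma paths_1: "paths 1 = {[1]}"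
proof -
  have "ls \<in> paths 1 \<longleftrightarrow> ls \<in> {[1]}" for ls
    by (cases ls) (simp_all add: Nil_in_paths_iff Cons_in_paths_iff paths_0)
  then show ?thesis by blast
qed

lemma paths_Suc_Suc: "paths (Suc (Suc s)) = (#) 1 ` paths (Suc s) \<union> (#) 2 ` paths s"
proof -
  have "ls \<in> paths (Suc (Suc s)) \<longleftrightarrow> ls \<in> (#) 1 ` paths (Suc s) \<union> (#) 2 ` paths s" for ls
    by (cases ls) (auto simp: Nil_in_paths_iff Cons_in_paths_iff)
  then show ?thesis by blast
qed

text \<open>For \<open>s = 0\<close> the only path is \<open>[]\<close>, whose last element is unspecified; below, \<open>s\<close> is positive
  wherever the value matters.\<close>

definition paths_ending_in_2 :: "nat \<Rightarrow> int list set" where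
  "paths_ending_in_2 s = {ls \<in> paths s. last ls = 2}"

lemma finite_paths_ending_in_2: "finite (paths_ending_in_2 s)"
  unfolding paths_ending_in_2_def using finite_paths by simp

lemma paths_ending_in_2_1: "paths_ending_in_2 1 = {}"
  unfolding paths_ending_in_2_def paths_1 by simp

lemma paths_ending_in_2_2: "paths_ending_in_2 2 = {[2]}"
proof -
  have "paths 2 = (#) 1 ` {[1]} \<union> (#) 2 ` {[]}"
    using paths_Suc_Suc[of 0] unfolding One_nat_def[symmetric] Suc_1 paths_1 paths_0 .
  then have "ls \<in> paths_ending_in_2 2 \<longleftrightarrow> ls \<in> {[2]}" for ls
    unfolding paths_ending_in_2_def mem_Collect_eq by simp fastforce
  then show ?thesis by blast
qed

text \<open>The sum \<open>s + 3\<close> leaves a nonempty remainder after the first part, so the last part is unaffected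
  by removing the first one.\<close>

lemma paths_ending_in_2_step:
  "paths_ending_in_2 (Suc (Suc (Suc s)))
     = (#) 1 ` paths_ending_in_2 (Suc (Suc s)) \<union> (#) 2 ` paths_ending_in_2 (Suc s)"
proof -
  have "ls \<noteq> []" if "ls \<in> paths (Suc t)" for ls t
    using that Nil_in_paths_iff by auto
  then show ?thesis
    unfolding paths_ending_in_2_def paths_Suc_Suc[of "Suc s"] by auto
qed

lemma sum_tuples:
  assumes "1 \<le> s"
  shows "(\<Sum>r=1..s. \<Sum>ls\<in>{ls \<in> tuples r s. Q ls}. f ls) = (\<Sum>ls\<in>{ls \<in> paths s. Q ls}. f ls)"
proof -
  have "length ls \<in> {1..s}" if "ls \<in> paths s" for ls
    using that length_paths_le[of ls s] assms by (cases ls) (auto simp: Nil_in_paths_iff)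
  then have "(\<Sum>r\<in>{1..s}. sum f {ls \<in> {ls \<in> paths s. Q ls}. length ls = r}) = sum f {ls \<in> paths s. Q ls}"
    by (intro sum.group) (use finite_paths in auto)
  moreover have "{ls \<in> {ls \<in> paths s. Q ls}. length ls = r} = {ls \<in> tuples r s. Q ls}" for r
    by (auto simp: paths_def tuples_def)
  ultimately show ?thesis by simp
qed

lemma alpha_eq_sum_paths:
  "alpha b m W lam k = Theta b m W lam * (\<Sum>ls\<in>paths k. path_weight b m W lam (int k) ls)"
  using sum_tuples[of k "tuple_weight b m W lam k" "\<lambda>ls. True"]
  by (cases "k = 0") (simp_all add: alpha_def paths_0 tuple_weight_eq)

lemma beta_eq_sum_paths:
  "beta b m W lam k = (\<Sum>ls\<in>paths_ending_in_2 (Suc k). path_weight b m W lam (int k) ls)"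
proof (cases "k = 0")
  case True
  then show ?thesis using paths_ending_in_2_1 by (simp add: beta_def)
next
  case False
  have "{ls \<in> tuples r (k + 1). ls ! (r - 1) = 2} = {ls \<in> tuples r (k + 1). last ls = 2}"
    if "r \<in> {1..k + 1}" for r
  proof -
    have "last ls = ls ! (r - 1)" if "ls \<in> tuples r (k + 1)" for ls
      using that \<open>r \<in> {1..k + 1}\<close> last_conv_nth[of ls] by (fastforce simp: tuples_def)
    then show ?thesis by auto
  qed
  then have "beta b m W lam k
      = (\<Sum>r=1..k + 1. \<Sum>ls\<in>{ls \<in> tuples r (k + 1). last ls = 2}. tuple_weight b m W lam k ls)"
    using False by (simp add: beta_def)
  then show ?thesis
    using sum_tuples[of "k + 1" "tuple_weight b m W lam k" "\<lambda>ls. last ls = 2"]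
    by (simp add: paths_ending_in_2_def tuple_weight_eq)
qed

text \<open>Splitting by the first part is the three-term recursion itself: \<open>factor1\<close> and \<open>factor2\<close> are the
  coefficients that express a solution at a point by its values at the two preceding points.\<close>

lemma sum_path_weight_step:
  assumes "finite X" "finite Y"
  shows "(\<Sum>ls\<in>(#) 1 ` X \<union> (#) 2 ` Y. path_weight b m W lam k ls)
    = factor1 b m W lam (k - 1) * (\<Sum>ls\<in>X. path_weight b m W lam (k - 1) ls)
      + factor2 b (k - 2) * (\<Sum>ls\<in>Y. path_weight b m W lam (k - 2) ls)"
proof -
  have "(\<Sum>ls\<in>(#) 1 ` X \<union> (#) 2 ` Y. path_weight b m W lam k ls)
      = (\<Sum>ls\<in>(#) 1 ` X. path_weight b m W lam k ls) + (\<Sum>ls\<in>(#) 2 ` Y. path_weight b m W lam k ls)"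
    using assms by (intro sum.union_disjoint) auto
  then show ?thesis
    by (simp add: sum.reindex path_factor_def sum_distrib_left)
qed

lemma alpha_1: "alpha b m W lam 1 = factor1 b m W lam 0 * alpha b m W lam 0"
  using paths_1 by (simp add: alpha_eq_sum_paths paths_0 path_factor_def)

lemma beta_1: "beta b m W lam 1 = factor2 b (- 1)"
  using paths_ending_in_2_2 by (simp add: beta_eq_sum_paths path_factor_def numeral_2_eq_2)

lemma alpha_step:
  "alpha b m W lam (Suc (Suc k))
     = factor1 b m W lam (int (Suc k)) * alpha b m W lam (Suc k) + factor2 b (int k) * alpha b m W lam k"
  unfolding alpha_eq_sum_paths paths_Suc_Suc sum_path_weight_step[OF finite_paths finite_paths]
  by (simp add: algebra_simps)

lemma beta_step:
  "beta b m W lam (Suc (Suc k))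
     = factor1 b m W lam (int (Suc k)) * beta b m W lam (Suc k) + factor2 b (int k) * beta b m W lam k"
  unfolding beta_eq_sum_paths paths_ending_in_2_step
    sum_path_weight_step[OF finite_paths_ending_in_2 finite_paths_ending_in_2]
  by simp

section \<open>The fundamental solution\<close>

text \<open>The solution \<open>u\<close> of \<open>(\<Delta> + W - \<lambda>) u = 0\<close> with \<open>u 0 = 1\<close>. The two summands come from the initial
  values \<open>(u 0, u 1) = (0, \<Theta>)\<close> and \<open>(1, 0)\<close> respectively.\<close>

definition fundamental_solution ::
    "(nat \<Rightarrow> nat \<Rightarrow> real) \<Rightarrow> (nat \<Rightarrow> real) \<Rightarrow> (nat \<Rightarrow> real) \<Rightarrow> real \<Rightarrow> nat \<Rightarrow> real" where
  "fundamental_solution b m W lam n =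
     (case n of 0 \<Rightarrow> 1 | Suc k \<Rightarrow> alpha b m W lam k + beta b m W lam k)"

lemma fundamental_solution_step:
  "fundamental_solution b m W lam (Suc (Suc k))
     = factor1 b m W lam (int k) * fundamental_solution b m W lam (Suc k)
       + factor2 b (int k - 1) * fundamental_solution b m W lam k"
proof (cases k)
  case 0
  have "beta b m W lam 0 = 0" by (simp add: beta_def)
  then show ?thesis
    using 0 alpha_1[of b m W lam] beta_1[of b m W lam] by (simp add: fundamental_solution_def)
next
  case (Suc j)
  then show ?thesis
    by (simp add: fundamental_solution_def alpha_step beta_step algebra_simps)
qed

lemma (in birth_death) fundamental_solution:
  "schr (\<lambda>x. W x - lam) (fundamental_solution b m W lam) x = 0"
proof (cases x)
  case 0
  then show ?thesis
    using b_pos[of 0] m_pos[of 0]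
    by (simp add: schr_0 fundamental_solution_def alpha_def beta_def Theta_def field_simps)
next
  case (Suc k)
  have nat: "nat (int k + 1) = Suc k" "nat (int k + 2) = Suc (Suc k)" "nat (int k) = k" by simp_all
  have factors: "factor1 b m W lam (int k)
      = 1 + (b k (Suc k) + (W (Suc k) - lam) * m (Suc k)) / b (Suc k) (Suc (Suc k))"
    "factor2 b (int k - 1) = - b k (Suc k) / b (Suc k) (Suc (Suc k))"
    unfolding factor1_def factor2_def using nat by (simp_all add: add.commute)
  have "fundamental_solution b m W lam (Suc (Suc k)) * b (Suc k) (Suc (Suc k))
      = (b (Suc k) (Suc (Suc k)) + b k (Suc k) + (W (Suc k) - lam) * m (Suc k))
          * fundamental_solution b m W lam (Suc k) - b k (Suc k) * fundamental_solution b m W lam k"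
    unfolding fundamental_solution_step factors
    using b_pos[of "Suc k"] by (simp add: field_simps)
  then have "b k (Suc k) * (fundamental_solution b m W lam (Suc k) - fundamental_solution b m W lam k)
      + b (Suc k) (Suc (Suc k)) * (fundamental_solution b m W lam (Suc k)
          - fundamental_solution b m W lam (Suc (Suc k)))
      = - ((W (Suc k) - lam) * fundamental_solution b m W lam (Suc k)) * m (Suc k)"
    by algebra
  then show ?thesis
    unfolding Suc schr_Suc using m_pos[of "Suc k"] by simp
qed

lemma suminf_ennreal_eq_top_iff:
  fixes f :: "nat \<Rightarrow> real"
  assumes "\<And>k. 0 \<le> f k"
  shows "(\<Sum>k. ennreal (f k)) = \<infinity> \<longleftrightarrow> \<not> summable f"
proof
  assume inf: "(\<Sum>k. ennreal (f k)) = \<infinity>"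
  show "\<not> summable f"
  proof
    assume "summable f"
    then have "(\<Sum>k. ennreal (f k)) = ennreal (suminf f)" by (rule suminf_ennreal2[OF assms])
    then show False using inf by simp
  qed
next
  assume "\<not> summable f"
  then show "(\<Sum>k. ennreal (f k)) = \<infinity>"
    using summable_suminf_not_top[of f] assms by (metis infinity_ennreal_def)
qed

theorem theorem3p3:
  fixes b :: "nat \<Rightarrow> nat \<Rightarrow> real" and m W :: "nat \<Rightarrow> real" and K :: real
  assumes "birth_death_chain b m"
    and "semibounded m (schroedinger b m W) K"
  shows "(\<exists>lam<K. (\<Sum>k. ennreal ((alpha b m W lam k + beta b m W lam k)\<^sup>2 * m (k + 1))) = \<infinity>)
     \<longleftrightarrow> essentially_self_adjoint m (schroedinger b m W)"
proof -
  have nonneg: "0 \<le> b x y" and sym: "b x y = b y x"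
    and pos: "0 < b x y \<longleftrightarrow> \<bar>int x - int y\<bar> = 1" and m: "0 < m x" for x y
    using assms(1) unfolding birth_death_chain_def by auto
  interpret birth_death m b
  proof
    show "0 < b x (Suc x)" for x using pos[of x "Suc x"] by simp
    show "b x y = 0" if "\<bar>int x - int y\<bar> \<noteq> 1" for x y
      using nonneg[of x y] pos[of x y] that by simp
  qed (rule m, rule sym)
  have "(\<Sum>k. ennreal ((alpha b m W lam k + beta b m W lam k)\<^sup>2 * m (k + 1))) = \<infinity>
      \<longleftrightarrow> essentially_self_adjoint m (schroedinger b m W)" if "lam < K" for lam
  proof -
    let ?u = "fundamental_solution b m W lam"
    have "(\<Sum>k. ennreal ((alpha b m W lam k + beta b m W lam k)\<^sup>2 * m (k + 1))) = \<infinity>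
        \<longleftrightarrow> \<not> summable (\<lambda>k. (?u (Suc k))\<^sup>2 * m (Suc k))"
      by (subst suminf_ennreal_eq_top_iff) (simp_all add: fundamental_solution_def)
    also have "\<dots> \<longleftrightarrow> ?u \<notin> l2 m"
      unfolding l2_def mem_Collect_eq summable_Suc_iff[of "\<lambda>k. (?u k)\<^sup>2 * m k"] ..
    also have "\<dots> \<longleftrightarrow> essentially_self_adjoint m (schroedinger b m W)"
      using essentially_self_adjoint_iff[OF assms(2) that fundamental_solution]
      by (simp add: fundamental_solution_def)
    finally show ?thesis .
  qed
  \<comment> \<open>The equivalence holds for every \<open>\<lambda> < K\<close>, so some \<open>\<lambda>\<close> works if and only if this one does.\<close>
  moreover have "K - 1 < K" by simp
  ultimately show ?thesis by blast
qed

end
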